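(* Let $p\in[2,997]$ be a prime, let $R=\mathbb{F}_p[X]$ and $\pi=X$. Let $A:=(R/\pi^3)(e\xrightarrow{a}f)$ be the path algebra over $R/\pi^3$ of the quiver with two vertices $e,f$ and one arrow $a:e\to f$. Then the Heller operator $\Omega:\underline{\mathrm{mod}}\text{-}A\to\underline{\mathrm{mod}}\text{-}A$ has a left adjoint.
   Context: $\mathrm{mod}\text{-}A$ is the category of finitely generated right $A$-modules, and $A$ is isomorphic to the ring of upper triangular $2\times 2$ matrices over $R/\pi^3$. The element $a$ lies in $eAf$; thus an object of $\mathrm{mod}\text{-}A$ amounts to a morphism $X\to Y$ of finitely generated $R/\pi^3$-modules, and a morphism to a commutative square. For a noetherian ring $A$, $\underline{\mathrm{mod}}\text{-}A$ is the factor category of $\mathrm{mod}\text{-}A$ modulo the full additive subcategory of projective modules (morphisms are identified if their difference factors over a projective module). The Heller operator $\Omega:\underline{\mathrm{mod}}\text{-}A\to\underline{\mathrm{mod}}\text{-}A$ is given on objects by choosing for each $X$ a short exact sequence $0\to\Omega X\to \mathrm{P}X\to X\to0$ with $\mathrm{P}X$ finitely generated projective; for $f:X\to Y$ one chooses a morphism $(f',\hat f,f)$ between the chosen sequences and sets $\Omega[f]:=[f']$. It is well defined up to isomorphism of functors. *)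

theory Defs
  imports
    "HOL-Algebra.UnivPoly"
    "HOL-Algebra.QuotRing"
    "HOL-Number_Theory.Residues"
    "HOL-Library.Infinite_Typeclass"
    "Graph_Theory.Arc_Walk"
begin

section \<open>Categories, functors, adjoints\<close>

text \<open>Hom-sets are indexed by their end points and need not be disjoint.
  In \<open>Comp C X Y Z g h\<close> the morphism \<open>h\<close> from \<open>X\<close> to \<open>Y\<close> is applied first.\<close>

record ('o, 'm) cat =
  Ob :: "'o set"
  Hom :: "'o \<Rightarrow> 'o \<Rightarrow> 'm set"
  Idn :: "'o \<Rightarrow> 'm"
  Comp :: "'o \<Rightarrow> 'o \<Rightarrow> 'o \<Rightarrow> 'm \<Rightarrow> 'm \<Rightarrow> 'm"

locale category =
  fixes C :: "('o, 'm) cat"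
  assumes Idn_closed: "X \<in> Ob C \<Longrightarrow> Idn C X \<in> Hom C X X"
    and Comp_closed:
      "\<lbrakk>X \<in> Ob C; Y \<in> Ob C; Z \<in> Ob C; h \<in> Hom C X Y; g \<in> Hom C Y Z\<rbrakk>
        \<Longrightarrow> Comp C X Y Z g h \<in> Hom C X Z"
    and Comp_Idn_left:
      "\<lbrakk>X \<in> Ob C; Y \<in> Ob C; h \<in> Hom C X Y\<rbrakk> \<Longrightarrow> Comp C X Y Y (Idn C Y) h = h"
    and Comp_Idn_right:
      "\<lbrakk>X \<in> Ob C; Y \<in> Ob C; h \<in> Hom C X Y\<rbrakk> \<Longrightarrow> Comp C X X Y h (Idn C X) = h"
    and Comp_assoc:
      "\<lbrakk>W \<in> Ob C; X \<in> Ob C; Y \<in> Ob C; Z \<in> Ob C;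
        h \<in> Hom C W X; g \<in> Hom C X Y; k \<in> Hom C Y Z\<rbrakk>
        \<Longrightarrow> Comp C W Y Z k (Comp C W X Y g h) = Comp C W X Z (Comp C X Y Z k g) h"

record ('o, 'm, 'o2, 'm2) functor_data =
  FOb :: "'o \<Rightarrow> 'o2"
  FHom :: "'o \<Rightarrow> 'o \<Rightarrow> 'm \<Rightarrow> 'm2"

definition is_functor ::
  "('o, 'm) cat \<Rightarrow> ('o2, 'm2) cat \<Rightarrow> ('o, 'm, 'o2, 'm2) functor_data \<Rightarrow> bool" where
  "is_functor C D F \<longleftrightarrow> category C \<and> category D \<and>
    (\<forall>X\<in>Ob C. FOb F X \<in> Ob D) \<and>
    (\<forall>X\<in>Ob C. \<forall>Y\<in>Ob C. \<forall>h\<in>Hom C X Y. FHom F X Y h \<in> Hom D (FOb F X) (FOb F Y)) \<and>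
    (\<forall>X\<in>Ob C. FHom F X X (Idn C X) = Idn D (FOb F X)) \<and>
    (\<forall>X\<in>Ob C. \<forall>Y\<in>Ob C. \<forall>Z\<in>Ob C. \<forall>h\<in>Hom C X Y. \<forall>g\<in>Hom C Y Z.
      FHom F X Z (Comp C X Y Z g h) =
      Comp D (FOb F X) (FOb F Y) (FOb F Z) (FHom F Y Z g) (FHom F X Y h))"

text \<open>\<open>L\<close> from \<open>D\<close> to \<open>C\<close> is left adjoint to \<open>G\<close> from \<open>C\<close> to \<open>D\<close>:
  there are bijections \<open>\<phi> X Y\<close> from \<open>Hom C (L X) Y\<close> to \<open>Hom D X (G Y)\<close>, natural in
  \<open>X\<close> and in \<open>Y\<close>.\<close>

definition is_left_adjoint ::
  "('o, 'm) cat \<Rightarrow> ('o2, 'm2) cat \<Rightarrow>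
   ('o2, 'm2, 'o, 'm) functor_data \<Rightarrow> ('o, 'm, 'o2, 'm2) functor_data \<Rightarrow> bool" where
  "is_left_adjoint C D L G \<longleftrightarrow> is_functor D C L \<and> is_functor C D G \<and>
    (\<exists>\<phi>.
      (\<forall>X\<in>Ob D. \<forall>Y\<in>Ob C. bij_betw (\<phi> X Y) (Hom C (FOb L X) Y) (Hom D X (FOb G Y))) \<and>
      (\<forall>X\<in>Ob D. \<forall>Y\<in>Ob C. \<forall>Y'\<in>Ob C. \<forall>h\<in>Hom C (FOb L X) Y. \<forall>g\<in>Hom C Y Y'.
        \<phi> X Y' (Comp C (FOb L X) Y Y' g h) =
        Comp D X (FOb G Y) (FOb G Y') (FHom G Y Y' g) (\<phi> X Y h)) \<and>
      (\<forall>X'\<in>Ob D. \<forall>X\<in>Ob D. \<forall>Y\<in>Ob C. \<forall>h\<in>Hom C (FOb L X) Y. \<forall>k\<in>Hom D X' X.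
        \<phi> X' Y (Comp C (FOb L X') (FOb L X) Y h (FHom L X' X k)) =
        Comp D X' X (FOb G Y) (\<phi> X Y h) k))"

definition has_left_adjoint ::
  "('o, 'm) cat \<Rightarrow> ('o2, 'm2) cat \<Rightarrow> ('o, 'm, 'o2, 'm2) functor_data \<Rightarrow> bool" where
  "has_left_adjoint C D G \<longleftrightarrow> (\<exists>L. is_left_adjoint C D L G)"

section \<open>Finitely generated right modules\<close>

text \<open>Right modules reuse the library's record of (left) modules:
  \<open>a \<odot>\<^bsub>M\<^esub> x\<close> stands for \<open>x\<close> acted upon by \<open>a\<close> from the right, which is
  why \<open>a \<otimes> b\<close> acts by \<open>a\<close> first.  The fields \<open>mult\<close> and \<open>one\<close> of the record
  play no role.\<close>

locale right_module = A?: ring A + M?: abelian_group M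
  for A :: "('a, 'r) ring_scheme" (structure) and M :: "('a, 'u, 's) module_scheme" (structure) +
  assumes ract_closed:
      "\<lbrakk>a \<in> carrier A; x \<in> carrier M\<rbrakk> \<Longrightarrow> a \<odot>\<^bsub>M\<^esub> x \<in> carrier M"
    and ract_ring_distr:
      "\<lbrakk>a \<in> carrier A; b \<in> carrier A; x \<in> carrier M\<rbrakk>
        \<Longrightarrow> (a \<oplus>\<^bsub>A\<^esub> b) \<odot>\<^bsub>M\<^esub> x = a \<odot>\<^bsub>M\<^esub> x \<oplus>\<^bsub>M\<^esub> b \<odot>\<^bsub>M\<^esub> x"
    and ract_module_distr:
      "\<lbrakk>a \<in> carrier A; x \<in> carrier M; y \<in> carrier M\<rbrakk>
        \<Longrightarrow> a \<odot>\<^bsub>M\<^esub> (x \<oplus>\<^bsub>M\<^esub> y) = a \<odot>\<^bsub>M\<^esub> x \<oplus>\<^bsub>M\<^esub> a \<odot>\<^bsub>M\<^esub> y"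
    and ract_mult:
      "\<lbrakk>a \<in> carrier A; b \<in> carrier A; x \<in> carrier M\<rbrakk>
        \<Longrightarrow> (a \<otimes>\<^bsub>A\<^esub> b) \<odot>\<^bsub>M\<^esub> x = b \<odot>\<^bsub>M\<^esub> (a \<odot>\<^bsub>M\<^esub> x)"
    and ract_one:
      "x \<in> carrier M \<Longrightarrow> \<one>\<^bsub>A\<^esub> \<odot>\<^bsub>M\<^esub> x = x"

definition fin_gen :: "('a, 'r) ring_scheme \<Rightarrow> ('a, 'u) module \<Rightarrow> bool" where
  "fin_gen A M \<longleftrightarrow>
    (\<exists>S. finite S \<and> S \<subseteq> carrier M \<and>
      (\<forall>x\<in>carrier M. \<exists>c\<in>S \<rightarrow> carrier A. x = (\<Oplus>\<^bsub>M\<^esub>s\<in>S. c s \<odot>\<^bsub>M\<^esub> s)))"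

text \<open>The objects of mod-A are the finitely generated right modules with carrier in a
  type \<open>'u\<close>.  If \<open>A\<close> is finite, so is every finitely generated module; then any
  infinite type \<open>'u\<close> contains an isomorphic copy of each of them.\<close>

definition fg_mods :: "('a, 'r) ring_scheme \<Rightarrow> ('a, 'u) module set" where
  "fg_mods A = {M. right_module A M \<and> fin_gen A M}"

definition rhom :: "('a, 'r) ring_scheme \<Rightarrow> ('a, 'u) module \<Rightarrow> ('a, 'u) module \<Rightarrow> ('u \<Rightarrow> 'u) set" where
  "rhom A M N = {h \<in> carrier M \<rightarrow>\<^sub>E carrier N.
    (\<forall>x\<in>carrier M. \<forall>y\<in>carrier M. h (x \<oplus>\<^bsub>M\<^esub> y) = h x \<oplus>\<^bsub>N\<^esub> h y) \<and>
    (\<forall>a\<in>carrier A. \<forall>x\<in>carrier M. h (a \<odot>\<^bsub>M\<^esub> x) = a \<odot>\<^bsub>N\<^esub> h x)}"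

definition projective :: "('a, 'r) ring_scheme \<Rightarrow> ('a, 'u) module \<Rightarrow> bool" where
  "projective A P \<longleftrightarrow> right_module A P \<and>
    (\<forall>M N :: ('a, 'u) module. \<forall>g h.
      right_module A M \<and> right_module A N \<and> g \<in> rhom A M N \<and> g ` carrier M = carrier N \<and>
      h \<in> rhom A P N \<longrightarrow>
      (\<exists>k\<in>rhom A P M. compose (carrier P) g k = h))"

section \<open>The stable category and the Heller operator\<close>

definition factors_proj ::
  "('a, 'r) ring_scheme \<Rightarrow> ('a, 'u) module \<Rightarrow> ('a, 'u) module \<Rightarrow> ('u \<Rightarrow> 'u) \<Rightarrow> bool" where
  "factors_proj A X Y h \<longleftrightarrow>
    (\<exists>P\<in>fg_mods A. projective A P \<and>
      (\<exists>u\<in>rhom A X P. \<exists>v\<in>rhom A P Y. h = compose (carrier X) v u))"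

definition stable_rel ::
  "('a, 'r) ring_scheme \<Rightarrow> ('a, 'u) module \<Rightarrow> ('a, 'u) module \<Rightarrow> (('u \<Rightarrow> 'u) \<times> ('u \<Rightarrow> 'u)) set" where
  "stable_rel A X Y = {(h, k). h \<in> rhom A X Y \<and> k \<in> rhom A X Y \<and>
    factors_proj A X Y (\<lambda>x\<in>carrier X. h x \<ominus>\<^bsub>Y\<^esub> k x)}"

definition stable_class ::
  "('a, 'r) ring_scheme \<Rightarrow> ('a, 'u) module \<Rightarrow> ('a, 'u) module \<Rightarrow> ('u \<Rightarrow> 'u) \<Rightarrow> ('u \<Rightarrow> 'u) set" where
  "stable_class A X Y h = stable_rel A X Y `` {h}"

definition stable_cat ::
  "('a, 'r) ring_scheme \<Rightarrow> (('a, 'u) module, ('u \<Rightarrow> 'u) set) cat" where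
  "stable_cat A =
    \<lparr>Ob = fg_mods A,
     Hom = \<lambda>X Y. rhom A X Y // stable_rel A X Y,
     Idn = \<lambda>X. stable_class A X X (\<lambda>x\<in>carrier X. x),
     Comp = \<lambda>X Y Z G H. \<Union>g\<in>G. \<Union>h\<in>H. stable_class A X Z (compose (carrier X) g h)\<rparr>"

definition short_exact ::
  "('a, 'r) ring_scheme \<Rightarrow> ('a, 'u) module \<Rightarrow> ('u \<Rightarrow> 'u) \<Rightarrow> ('a, 'u) module \<Rightarrow> ('u \<Rightarrow> 'u)
    \<Rightarrow> ('a, 'u) module \<Rightarrow> bool" where
  "short_exact A K i P q X \<longleftrightarrow>
    i \<in> rhom A K P \<and> q \<in> rhom A P X \<and>
    inj_on i (carrier K) \<and> i ` carrier K = a_kernel P X q \<and> q ` carrier P = carrier X"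

text \<open>The Heller operator depends on choices; \<open>heller_operator A \<Omega>\<close> says that \<open>\<Omega>\<close> arises from
  some choice of short exact sequences and of lifts of morphisms to them.  That such an
  \<open>\<Omega>\<close> is a functor is not part of this definition.\<close>

definition heller_operator ::
  "('a, 'r) ring_scheme \<Rightarrow>
   (('a, 'u) module, ('u \<Rightarrow> 'u) set, ('a, 'u) module, ('u \<Rightarrow> 'u) set) functor_data \<Rightarrow> bool" where
  "heller_operator A \<Omega> \<longleftrightarrow>
    (\<exists>P i q.
      (\<forall>X\<in>fg_mods A.
        FOb \<Omega> X \<in> fg_mods A \<and> P X \<in> fg_mods A \<and> projective A (P X) \<and>
        short_exact A (FOb \<Omega> X) (i X) (P X) (q X) X) \<and>
      (\<forall>X\<in>fg_mods A. \<forall>Y\<in>fg_mods A. \<forall>h\<in>rhom A X Y.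
        \<exists>h'\<in>rhom A (FOb \<Omega> X) (FOb \<Omega> Y). \<exists>k\<in>rhom A (P X) (P Y).
          compose (carrier (P X)) (q Y) k = compose (carrier (P X)) h (q X) \<and>
          compose (carrier (FOb \<Omega> X)) (i Y) h' = compose (carrier (FOb \<Omega> X)) k (i X) \<and>
          FHom \<Omega> X Y (stable_class A X Y h) = stable_class A (FOb \<Omega> X) (FOb \<Omega> Y) h'))"

section \<open>Path algebras\<close>

text \<open>A path is a pair of its start vertex and its list of arrows, the trivial path at \<open>u\<close>
  being \<open>(u, [])\<close>.\<close>

definition paths :: "('v, 'e) pre_digraph \<Rightarrow> ('v \<times> 'e list) set" where
  "paths Q = {(u, as). \<exists>w. pre_digraph.awalk Q u as w}"

text \<open>Elements are the finitely supported coefficient functions on paths.  Paths are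
  multiplied by concatenation from left to right: an arrow \<open>a\<close> from \<open>u\<close> to \<open>w\<close> satisfies
  \<open>u a w = a\<close>, with the vertices read as trivial paths.\<close>

definition path_algebra ::
  "('r, 's) ring_scheme \<Rightarrow> ('v, 'e) pre_digraph \<Rightarrow> ('v \<times> 'e list \<Rightarrow> 'r) ring" where
  "path_algebra S Q =
    \<lparr>carrier = {x. (\<forall>r. x r \<in> carrier S) \<and> (\<forall>r. r \<notin> paths Q \<longrightarrow> x r = \<zero>\<^bsub>S\<^esub>) \<and>
       finite {r. x r \<noteq> \<zero>\<^bsub>S\<^esub>}},
     monoid.mult = \<lambda>x y (u, as).
       \<Oplus>\<^bsub>S\<^esub>k\<in>{..length as}.
         x (u, take k as) \<otimes>\<^bsub>S\<^esub> y (pre_digraph.awlast Q u (take k as), drop k as),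
     one = \<lambda>(u, as). if u \<in> verts Q \<and> as = [] then \<one>\<^bsub>S\<^esub> else \<zero>\<^bsub>S\<^esub>,
     zero = \<lambda>r. \<zero>\<^bsub>S\<^esub>,
     add = \<lambda>x y r. x r \<oplus>\<^bsub>S\<^esub> y r\<rparr>"

datatype vertex = V_e | V_f

datatype arrow = Arr_a

definition quiver_ef :: "(vertex, arrow) pre_digraph" where
  "quiver_ef = \<lparr>verts = {V_e, V_f}, arcs = {Arr_a}, tail = \<lambda>_. V_e, head = \<lambda>_. V_f\<rparr>"

section \<open>The algebra in question\<close>

definition Fp_X :: "nat \<Rightarrow> (int, nat \<Rightarrow> int) up_ring" where
  "Fp_X p = UP (residue_ring (int p))"

definition pi_X :: "nat \<Rightarrow> nat \<Rightarrow> int" where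
  "pi_X p = up_ring.monom (Fp_X p) \<one>\<^bsub>residue_ring (int p)\<^esub> 1"

definition R_mod_pi3 :: "nat \<Rightarrow> (nat \<Rightarrow> int) set ring" where
  "R_mod_pi3 p = Fp_X p Quot (PIdl\<^bsub>Fp_X p\<^esub> (pi_X p [^]\<^bsub>Fp_X p\<^esub> (3::nat)))"

definition alg_A :: "nat \<Rightarrow> (vertex \<times> arrow list \<Rightarrow> (nat \<Rightarrow> int) set) ring" where
  "alg_A p = path_algebra (R_mod_pi3 p) quiver_ef"

text \<open>\<open>right_module A M\<close> includes \<open>ring A\<close>, so the following facts are
  needed for \<open>fg_mods (alg_A p)\<close> to be nonempty.\<close>


lemma paths_quiver_ef: "(r \<in> paths quiver_ef) = (r = (V_e, []) \<or> r = (V_f, []) \<or> r = (V_e, [Arr_a]))"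
proof -
  have h: "pre_digraph.cas quiver_ef u as w \<Longrightarrow> u = V_f \<Longrightarrow> as = []" for u as w
    by (cases as) (auto simp: pre_digraph.cas.simps quiver_ef_def)
  obtain u as where r: "r = (u, as)" by (cases r)
  have "\<And>u. u \<in> {V_e, V_f}" by (metis vertex.exhaust insertCI)
  show ?thesis
  proof (cases as)
    case Nil then show ?thesis unfolding r
      by (cases u) (auto simp: paths_def pre_digraph.awalk_def pre_digraph.cas.simps quiver_ef_def)
  next
    case (Cons a bs)
    have [simp]: "a = Arr_a" by (cases a) simp
    have "pre_digraph.cas quiver_ef u as w \<Longrightarrow> u = V_e \<and> bs = []" for w
      using h[of V_f bs w] unfolding Cons by (auto simp: pre_digraph.cas.simps quiver_ef_def)
    moreover have "pre_digraph.cas quiver_ef V_e [Arr_a] V_f"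
      by (auto simp: pre_digraph.cas.simps quiver_ef_def)
    ultimately show ?thesis unfolding r Cons
      by (auto simp: paths_def pre_digraph.awalk_def) (auto simp: quiver_ef_def)
  qed
qed

lemma wf_digraph_quiver_ef: "wf_digraph quiver_ef" by unfold_locales (auto simp: quiver_ef_def)

lemma path_algebra_ef_mem: "x \<in> carrier (path_algebra S quiver_ef) \<longleftrightarrow>
   (\<forall>r. x r \<in> carrier S) \<and> (\<forall>r. r \<notin> paths quiver_ef \<longrightarrow> x r = \<zero>\<^bsub>S\<^esub>)"
proof -
  have "finite {r. x r \<noteq> \<zero>\<^bsub>S\<^esub>}" if "\<forall>r. r \<notin> paths quiver_ef \<longrightarrow> x r = \<zero>\<^bsub>S\<^esub>"
    by (rule finite_subset[of _ "{(V_e, []), (V_f, []), (V_e, [Arr_a])}"]) (use that paths_quiver_ef in auto)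
  thus ?thesis by (auto simp: path_algebra_def)
qed

lemma (in ring) path_algebra_ef_mult:
  assumes "x \<in> carrier (path_algebra R quiver_ef)" "y \<in> carrier (path_algebra R quiver_ef)"
  defines "z \<equiv> x \<otimes>\<^bsub>path_algebra R quiver_ef\<^esub> y"
  shows "z (V_e, []) = x (V_e, []) \<otimes> y (V_e, [])"
    "z (V_f, []) = x (V_f, []) \<otimes> y (V_f, [])"
    "z (V_e, [Arr_a]) = x (V_e, []) \<otimes> y (V_e, [Arr_a]) \<oplus> x (V_e, [Arr_a]) \<otimes> y (V_f, [])"
    "r \<notin> paths quiver_ef \<Longrightarrow> z r = \<zero>"
proof -
  have c[simp]: "x r \<in> carrier R" "y r \<in> carrier R" for r using assms unfolding path_algebra_ef_mem by blast+
  show "z (V_e, []) = x (V_e, []) \<otimes> y (V_e, [])"  "z (V_f, []) = x (V_f, []) \<otimes> y (V_f, [])"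
    unfolding z_def path_algebra_def by (simp_all add: pre_digraph.awalk_verts.simps)
  show "z (V_e, [Arr_a]) = x (V_e, []) \<otimes> y (V_e, [Arr_a]) \<oplus> x (V_e, [Arr_a]) \<otimes> y (V_f, [])"
    unfolding z_def path_algebra_def
    by (simp add: pre_digraph.awalk_verts.simps quiver_ef_def atMost_Suc a_comm)
  assume r: "r \<notin> paths quiver_ef"
  obtain u as where u: "r = (u, as)" by (cases r)
  have "x (u, take k as) \<otimes> y (pre_digraph.awlast quiver_ef u (take k as), drop k as) = \<zero>" for k
  proof (cases "(u, take k as) \<in> paths quiver_ef \<and> (pre_digraph.awlast quiver_ef u (take k as), drop k as) \<in> paths quiver_ef")
    case True
    then obtain w w' where 1: "pre_digraph.awalk quiver_ef u (take k as) w"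
      "pre_digraph.awalk quiver_ef (pre_digraph.awlast quiver_ef u (take k as)) (drop k as) w'"
      unfolding paths_def by auto
    then have "w = pre_digraph.awlast quiver_ef u (take k as)"
      using wf_digraph.awalkE'[OF wf_digraph_quiver_ef] by metis
    with 1 have "pre_digraph.awalk quiver_ef u (take k as @ drop k as) w'"
      using wf_digraph.awalk_appendI[OF wf_digraph_quiver_ef] by blast
    then show ?thesis using r u unfolding paths_def by auto
  next
    case False then show ?thesis using assms by (auto simp: path_algebra_ef_mem)
  qed
  then show "z r = \<zero>" unfolding z_def path_algebra_def u by simp
qed

lemma path_algebra_ef_eqI: assumes "x \<in> carrier (path_algebra S quiver_ef)" "y \<in> carrier (path_algebra S quiver_ef)"
  "x (V_e, []) = y (V_e, [])"   "x (V_f, []) = y (V_f, [])"   "x (V_e, [Arr_a]) = y (V_e, [Arr_a])" 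
  shows "x = y"
  using assms by (intro ext) (metis paths_quiver_ef path_algebra_ef_mem)

lemma (in ring) ring_path_algebra_ef: "ring (path_algebra R quiver_ef)"
proof -
  let ?P = "path_algebra R quiver_ef"
  have ad: "(x \<oplus>\<^bsub>?P\<^esub> y) r = x r \<oplus> y r" "\<zero>\<^bsub>?P\<^esub> r = \<zero>" for x y r by (simp_all add: path_algebra_def)
  have on: "\<one>\<^bsub>?P\<^esub> (V_e, []) = \<one>" "\<one>\<^bsub>?P\<^esub> (V_f, []) = \<one>" "\<one>\<^bsub>?P\<^esub> (V_e, [Arr_a]) = \<zero>" 
     by (simp_all add: path_algebra_def quiver_ef_def)
  have onc: "\<one>\<^bsub>?P\<^esub> \<in> carrier ?P"
    unfolding path_algebra_ef_mem paths_quiver_ef by (auto simp: path_algebra_def quiver_ef_def)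
  have adc: "x \<oplus>\<^bsub>?P\<^esub> y \<in> carrier ?P" if "x \<in> carrier ?P" "y \<in> carrier ?P" for x y
    using that by (auto simp: path_algebra_ef_mem ad)
  have mc: "x \<otimes>\<^bsub>?P\<^esub> y \<in> carrier ?P" if "x \<in> carrier ?P" "y \<in> carrier ?P" for x y
  proof -
    have c[simp]: "x r \<in> carrier R" "y r \<in> carrier R" for r using that unfolding path_algebra_ef_mem by blast+
    have "(x \<otimes>\<^bsub>?P\<^esub> y) r \<in> carrier R" for r
      by (cases "r \<in> paths quiver_ef") (auto simp: path_algebra_ef_mult[OF that] paths_quiver_ef)
    then show ?thesis using path_algebra_ef_mult(4)[OF that] unfolding path_algebra_ef_mem by blast
  qed
  have cc: "x r \<in> carrier R" if "x \<in> carrier ?P" for x r using that unfolding path_algebra_ef_mem by blast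
  show ?thesis
  proof (rule ringI)
    show "abelian_group ?P"
    proof (rule abelian_groupI)
      fix x assume x: "x \<in> carrier ?P"
      show "\<exists>y\<in>carrier ?P. y \<oplus>\<^bsub>?P\<^esub> x = \<zero>\<^bsub>?P\<^esub>"
        by (rule bexI[of _ "\<lambda>r. \<ominus> x r"]) (use x in \<open>auto simp: path_algebra_ef_mem ad l_neg\<close>)
    qed (auto simp: path_algebra_ef_mem ad a_ac)
    show "monoid ?P"
      by (rule monoidI) (auto intro!: path_algebra_ef_eqI mc onc simp: path_algebra_ef_mult mc onc on cc l_distr r_distr m_assoc a_assoc)
  qed (auto intro!: path_algebra_ef_eqI mc adc simp: path_algebra_ef_mult mc adc ad cc l_distr r_distr a_ac)
qed

lemma cring_R_mod_pi3: assumes "prime p" shows "cring (R_mod_pi3 p)"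
proof -
  interpret F: residues_prime p "residue_ring (int p)" using assms by unfold_locales (auto)
  interpret U: UP_cring "residue_ring (int p)" "Fp_X p"
    by unfold_locales (simp add: Fp_X_def)
  have "pi_X p [^]\<^bsub>Fp_X p\<^esub> (3::nat) \<in> carrier (Fp_X p)"
    unfolding pi_X_def using U.P.nat_pow_closed U.monom_closed by simp
  then interpret ideal "PIdl\<^bsub>Fp_X p\<^esub> (pi_X p [^]\<^bsub>Fp_X p\<^esub> (3::nat))" "Fp_X p"
    by (rule U.P.cgenideal_ideal)
  show ?thesis unfolding R_mod_pi3_def using U.P.is_cring quotient_is_cring by blast
qed

lemma ring_alg_A: "prime p \<Longrightarrow> ring (alg_A p)"
  unfolding alg_A_def using ring.ring_path_algebra_ef cring.axioms(1) cring_R_mod_pi3 by blast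

end

theory Submission
  imports Defs
begin

text \<open>
  The algebra \<open>A\<close> is finite, and this is all that is used of it.  A finitely generated \<open>X\<close> then has
  only finitely many linear forms, which combine to a map \<open>u\<close> from \<open>X\<close> to a finitely generated free
  module \<open>Q\<close> such that every map from \<open>X\<close> to a finitely generated projective module extends
  along \<open>u\<close>.  The left adjoint sends \<open>X\<close> to the cokernel \<open>C\<close> of \<open>u\<close> (Auslander and Reiten's
  \<open>Tr \<Omega> Tr\<close>).  Lifting \<open>Q \<rightarrow> C\<close> to the chosen projective \<open>P C\<close> over \<open>C\<close> and restricting to \<open>X\<close>
  gives the unit \<open>\<eta>: X \<rightarrow> \<Omega> C\<close>.  For \<open>g: X \<rightarrow> \<Omega> Y\<close>, the composite of \<open>g\<close> with
  \<open>\<Omega> Y \<rightarrow> P Y\<close> extends to \<open>Q \<rightarrow> P Y\<close> and so induces the required map \<open>C \<rightarrow> Y\<close>; the same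
  extension property shows that it is unique in the stable category.
\<close>

subsection \<open>Linear maps\<close>

text \<open>The obstacle is that an object need not embed in a projective. Seen as a map of
  \<open>R/\<pi>^3\<close>-modules, every projective is an injective map, and so is each of its
  submodules; an object given by a map with a kernel therefore lies in no projective. Hence
  \<open>u\<close> may fail to be injective, X need not be the syzygy of its cokernel C, and
  \<open>\<eta>\<close> is in general no isomorphism. What survives is the universal property: it
  uses that Q maps onto C with kernel the image of \<open>u\<close>, and that maps to projectives
  extend along \<open>u\<close>. Finiteness of A enters in three ways. Finitely generated modules
  are those with finite carrier, so quotients are again objects; all of Hom(X, A) can serve as index
  set of Q, without a choice of generators; and free modules can be placed in the infinite type
  \<open>'u\<close>. \<open>heller_operator\<close> supplies choices only. That the stable category
  is a category, and that the choices define a functor on it, has to be proved before the adjunction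
  can be stated.\<close>

lemma (in abelian_group) minus_zero_right: "x \<in> carrier G \<Longrightarrow> x \<ominus> \<zero> = x"
  using l_neg[OF zero_closed] by (simp add: minus_eq)

lemma (in abelian_group) minus_add_cancel:
  "\<lbrakk>x \<in> carrier G; y \<in> carrier G\<rbrakk> \<Longrightarrow> (x \<ominus> y) \<oplus> y = x"
  by (simp add: minus_eq a_assoc l_neg)

lemma (in abelian_group) minus_eq_zero_iff:
  assumes "x \<in> carrier G" "y \<in> carrier G"
  shows "x \<ominus> y = \<zero> \<longleftrightarrow> x = y"
  using minus_add_cancel[OF assms] assms by (auto simp: minus_eq r_neg)

text \<open>Unlike \<open>rhom\<close>, no extensionality is required, so that composites and sums
  of maps can be written as plain functions, and the two modules may have different element types,
  as for linear forms with values in \<open>regular A\<close>.\<close>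

definition lin :: "('a, 'r) ring_scheme \<Rightarrow> ('a, 'u, 's) module_scheme \<Rightarrow> ('a, 'v, 't) module_scheme
    \<Rightarrow> ('u \<Rightarrow> 'v) \<Rightarrow> bool" where
  "lin A M N h \<longleftrightarrow> h \<in> carrier M \<rightarrow> carrier N \<and>
    (\<forall>x\<in>carrier M. \<forall>y\<in>carrier M. h (x \<oplus>\<^bsub>M\<^esub> y) = h x \<oplus>\<^bsub>N\<^esub> h y) \<and>
    (\<forall>a\<in>carrier A. \<forall>x\<in>carrier M. h (a \<odot>\<^bsub>M\<^esub> x) = a \<odot>\<^bsub>N\<^esub> h x)"

lemma rhom_iff: "h \<in> rhom A M N \<longleftrightarrow> lin A M N h \<and> h \<in> extensional (carrier M)"
  by (auto simp: rhom_def lin_def PiE_def)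

lemma linD: "lin A M N h \<Longrightarrow> x \<in> carrier M \<Longrightarrow> h x \<in> carrier N"
  "lin A M N h \<Longrightarrow> x \<in> carrier M \<Longrightarrow> y \<in> carrier M \<Longrightarrow> h (x \<oplus>\<^bsub>M\<^esub> y) = h x \<oplus>\<^bsub>N\<^esub> h y"
  "lin A M N h \<Longrightarrow> a \<in> carrier A \<Longrightarrow> x \<in> carrier M \<Longrightarrow> h (a \<odot>\<^bsub>M\<^esub> x) = a \<odot>\<^bsub>N\<^esub> h x"
  by (auto simp: lin_def)

lemma right_module_abelian_group: "right_module A M \<Longrightarrow> abelian_group M"
  by (simp add: right_module_def)

lemma lin_cong:
  assumes "right_module A M" "\<And>x. x \<in> carrier M \<Longrightarrow> h x = k x"
  shows "lin A M N h \<longleftrightarrow> lin A M N k"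
proof -
  interpret right_module A M by fact
  show ?thesis using assms(2) unfolding lin_def Pi_iff by (simp add: ract_closed cong: ball_cong)
qed

lemma lin_restrict:
  assumes "right_module A M" "lin A M N h"
  shows "lin A M N (restrict h (carrier M))"
  using assms lin_cong[OF assms(1), where k = h and h = "restrict h (carrier M)" and N = N]
  by simp

lemma rhom_restrict:
  assumes "right_module A M" "lin A M N h"
  shows "restrict h (carrier M) \<in> rhom A M N"
  using lin_restrict[OF assms] by (simp add: rhom_iff)

lemma lin_compose:
  assumes "lin A L M h" "lin A M N k"
  shows "lin A L N (\<lambda>x. k (h x))"
  using assms by (auto simp: lin_def Pi_iff)

lemma lin_id: "lin A M M (\<lambda>x. x)"
  by (auto simp: lin_def)

lemma lin_zero_arg:
  assumes "right_module A M" "right_module A N" "lin A M N h"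
  shows "h \<zero>\<^bsub>M\<^esub> = \<zero>\<^bsub>N\<^esub>"
proof -
  interpret M: right_module A M by fact
  interpret N: right_module A N by fact
  have "h \<zero>\<^bsub>M\<^esub> \<oplus>\<^bsub>N\<^esub> h \<zero>\<^bsub>M\<^esub> = h \<zero>\<^bsub>M\<^esub> \<oplus>\<^bsub>N\<^esub> \<zero>\<^bsub>N\<^esub>"
    using linD[OF assms(3)] by (metis M.M.r_zero M.M.zero_closed N.M.r_zero)
  then show ?thesis using linD[OF assms(3)] by simp
qed

lemma lin_minus_arg:
  assumes "right_module A M" "right_module A N" "lin A M N h" "x \<in> carrier M" "y \<in> carrier M"
  shows "h (x \<ominus>\<^bsub>M\<^esub> y) = h x \<ominus>\<^bsub>N\<^esub> h y"
proof -
  interpret M: right_module A M by fact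
  interpret N: right_module A N by fact
  have "h (x \<ominus>\<^bsub>M\<^esub> y) \<oplus>\<^bsub>N\<^esub> h y = h x"
    using assms(4,5) linD(2)[OF assms(3), of "x \<ominus>\<^bsub>M\<^esub> y" y, symmetric]
    by (simp add: M.M.minus_eq M.M.a_assoc M.M.l_neg)
  then show ?thesis using assms(4,5) linD(1)[OF assms(3)] 
    by (metis M.M.minus_closed N.M.minus_eq N.M.a_assoc N.M.r_neg N.M.r_zero N.M.a_inv_closed)
qed

context right_module
begin

lemma ract_zero_right: "a \<in> carrier A \<Longrightarrow> a \<odot>\<^bsub>M\<^esub> \<zero>\<^bsub>M\<^esub> = \<zero>\<^bsub>M\<^esub>"
  using ract_module_distr[of a "\<zero>\<^bsub>M\<^esub>" "\<zero>\<^bsub>M\<^esub>"] ract_closed[of a "\<zero>\<^bsub>M\<^esub>"] by simp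

lemma ract_zero_left:
  assumes "x \<in> carrier M"
  shows "\<zero> \<odot>\<^bsub>M\<^esub> x = \<zero>\<^bsub>M\<^esub>"
  using ract_ring_distr[of \<zero> \<zero> x] ract_closed[of \<zero> x] assms by simp

lemma ract_minus:
  assumes "a \<in> carrier A" "x \<in> carrier M" "y \<in> carrier M"
  shows "a \<odot>\<^bsub>M\<^esub> (x \<ominus>\<^bsub>M\<^esub> y) = a \<odot>\<^bsub>M\<^esub> x \<ominus>\<^bsub>M\<^esub> a \<odot>\<^bsub>M\<^esub> y"
proof -
  have "a \<odot>\<^bsub>M\<^esub> (x \<ominus>\<^bsub>M\<^esub> y) \<oplus>\<^bsub>M\<^esub> a \<odot>\<^bsub>M\<^esub> y = a \<odot>\<^bsub>M\<^esub> x"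
    using assms ract_module_distr[of a "x \<ominus>\<^bsub>M\<^esub> y" y, symmetric]
    by (simp add: M.minus_eq M.a_assoc M.l_neg)
  then show ?thesis using assms ract_closed
    by (metis M.minus_closed M.minus_eq M.a_assoc M.r_neg M.r_zero M.a_inv_closed)
qed


end

lemma lin_zero:
  assumes "right_module A M" "right_module A N"
  shows "lin A M N (\<lambda>x. \<zero>\<^bsub>N\<^esub>)"
proof -
  interpret N: right_module A N by fact
  show ?thesis by (auto simp: lin_def N.ract_zero_right)
qed

lemma lin_add:
  assumes "right_module A N" "lin A M N h" "lin A M N k"
  shows "lin A M N (\<lambda>x. h x \<oplus>\<^bsub>N\<^esub> k x)"
proof -
  interpret N: right_module A N by fact
  show ?thesis
    using linD[OF assms(2)] linD[OF assms(3)]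
    by (auto simp: lin_def N.ract_module_distr N.M.a_ac)
qed

lemma lin_minus:
  assumes "right_module A N" "lin A M N h" "lin A M N k"
  shows "lin A M N (\<lambda>x. h x \<ominus>\<^bsub>N\<^esub> k x)"
proof -
  interpret N: right_module A N by fact
  show ?thesis
    using linD[OF assms(2)] linD[OF assms(3)]
    by (simp add: lin_def N.ract_minus) (simp add: N.M.minus_eq N.M.minus_add N.M.a_ac N.M.minus_closed)
qed

lemma lin_finsum:
  assumes "right_module A N" "finite J" "\<And>j. j \<in> J \<Longrightarrow> lin A M N (h j)" "right_module A M"
  shows "lin A M N (\<lambda>x. \<Oplus>\<^bsub>N\<^esub>j\<in>J. h j x)"
  using assms(2,3)
proof (induction J rule: finite_induct)
  case empty
  interpret N: right_module A N by fact
  show ?case by (simp add: lin_zero assms)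
next
  case (insert i J)
  interpret N: right_module A N by fact
  interpret M: right_module A M by fact
  have "lin A M N (\<lambda>x. h i x \<oplus>\<^bsub>N\<^esub> (\<Oplus>\<^bsub>N\<^esub>j\<in>J. h j x))"
    using insert by (intro lin_add assms(1)) auto
  moreover have "(\<Oplus>\<^bsub>N\<^esub>j\<in>insert i J. h j x) = h i x \<oplus>\<^bsub>N\<^esub> (\<Oplus>\<^bsub>N\<^esub>j\<in>J. h j x)" if "x \<in> carrier M" for x
    using insert that linD(1) by (subst N.M.finsum_insert) (fastforce simp: Pi_iff)+
  ultimately show ?case using lin_cong[OF assms(4)] by (metis (no_types, lifting))
qed

lemma lin_of_finsum:
  assumes "right_module A M" "right_module A N" "lin A M N h" "finite J" "f \<in> J \<rightarrow> carrier M"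
  shows "h (\<Oplus>\<^bsub>M\<^esub>j\<in>J. f j) = (\<Oplus>\<^bsub>N\<^esub>j\<in>J. h (f j))"
  using assms(4,5)
proof (induction J rule: finite_induct)
  case empty
  interpret N: right_module A N by fact
  interpret M: right_module A M by fact
  show ?case using lin_zero_arg[OF assms(1-3)] by simp
next
  case (insert i J)
  interpret N: right_module A N by fact
  interpret M: right_module A M by fact
  have f: "f \<in> J \<rightarrow> carrier M" "f i \<in> carrier M" using insert.prems by auto
  have hf: "(\<lambda>j. h (f j)) \<in> J \<rightarrow> carrier N" "h (f i) \<in> carrier N"
    using f linD(1)[OF assms(3)] by auto
  show ?case
    unfolding M.M.finsum_insert[OF insert.hyps f] N.M.finsum_insert[OF insert.hyps hf]
    using linD(2)[OF assms(3) f(2) M.M.finsum_closed[OF f(1)]] insert.IH[OF f(1)] by simp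
qed

text \<open>Applied with \<open>r\<close> injective, to transport a module to another type, and with \<open>r\<close>
  a choice of coset representatives, to form quotients without leaving the type.\<close>

lemma ex_image_module:
  fixes N :: "('a, 'v, 's) module_scheme" and r :: "'v \<Rightarrow> 'u"
  assumes N: "right_module A N"
    and add: "\<And>x x' y y'. \<lbrakk>x \<in> carrier N; x' \<in> carrier N; y \<in> carrier N; y' \<in> carrier N;
      r x = r x'; r y = r y'\<rbrakk> \<Longrightarrow> r (x \<oplus>\<^bsub>N\<^esub> y) = r (x' \<oplus>\<^bsub>N\<^esub> y')"
    and act: "\<And>a x x'. \<lbrakk>a \<in> carrier A; x \<in> carrier N; x' \<in> carrier N; r x = r x'\<rbrakk>
      \<Longrightarrow> r (a \<odot>\<^bsub>N\<^esub> x) = r (a \<odot>\<^bsub>N\<^esub> x')"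
  shows "\<exists>M :: ('a, 'u) module. right_module A M \<and> carrier M = r ` carrier N \<and> lin A N M r"
proof -
  interpret N: right_module A N by fact
  \<comment> \<open>Preimages chosen through \<open>s\<close> make the operations on the image
    definable; the congruence hypotheses \<open>add\<close> and \<open>act\<close> then remove the
    dependence on that choice.\<close>
  define s where "s = inv_into (carrier N) r"
  have s: "s z \<in> carrier N" "r (s z) = z" if "z \<in> r ` carrier N" for z
    unfolding s_def using that by (auto intro: inv_into_into f_inv_into_f)
  define M :: "('a, 'u) module" where
    "M = \<lparr>carrier = r ` carrier N, monoid.mult = undefined, one = undefined,
      zero = r \<zero>\<^bsub>N\<^esub>, add = \<lambda>x y. r (s x \<oplus>\<^bsub>N\<^esub> s y), smult = \<lambda>a x. r (a \<odot>\<^bsub>N\<^esub> s x)\<rparr>"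
  have c: "carrier M = r ` carrier N" "\<zero>\<^bsub>M\<^esub> = r \<zero>\<^bsub>N\<^esub>" by (simp_all add: M_def)
  have a: "r x \<oplus>\<^bsub>M\<^esub> r y = r (x \<oplus>\<^bsub>N\<^esub> y)" if "x \<in> carrier N" "y \<in> carrier N" for x y
    using that s by (simp add: M_def) (intro add; simp)
  have m: "a \<odot>\<^bsub>M\<^esub> r x = r (a \<odot>\<^bsub>N\<^esub> x)" if "a \<in> carrier A" "x \<in> carrier N" for a x
    using that s by (simp add: M_def) (intro act; simp)
  have "\<exists>y\<in>carrier N. r (x \<oplus>\<^bsub>N\<^esub> y) = r \<zero>\<^bsub>N\<^esub>" if "x \<in> carrier N" for x
    using that N.M.r_neg N.M.a_inv_closed by metis
  then have "abelian_group M"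
    by (intro abelian_groupI) (auto simp: c a N.M.a_ac)
  then have "right_module A M"
    unfolding right_module_def right_module_axioms_def
    by (auto simp: c a m N.ract_closed N.ract_ring_distr N.ract_module_distr N.ract_mult N.ract_one N.A.ring_axioms)
  then show ?thesis using c a m by (auto simp: lin_def)
qed

subsection \<open>Free and projective modules\<close>

lemma (in right_module) finsum_delta:
  assumes "finite J" "k \<in> J" "m \<in> J \<rightarrow> carrier M"
  shows "(\<Oplus>\<^bsub>M\<^esub>j\<in>J. (if k = j then \<one> else \<zero>) \<odot>\<^bsub>M\<^esub> m j) = m k"
proof -
  have "(\<Oplus>\<^bsub>M\<^esub>j\<in>J. (if k = j then \<one> else \<zero>) \<odot>\<^bsub>M\<^esub> m j) = (\<Oplus>\<^bsub>M\<^esub>j\<in>J. if k = j then m j else \<zero>\<^bsub>M\<^esub>)"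
    using assms by (intro M.finsum_cong') (auto simp: ract_one ract_zero_left Pi_iff)
  then show ?thesis using M.finsum_singleton[OF assms(2,1,3)] by simp
qed

text \<open>Finitely many generators and a finite ring leave finitely many linear combinations;
  conversely, a finite module is generated by its whole carrier. Being an object of the category
  thereby becomes a matter of counting.\<close>

lemma fg_mods_iff_finite:
  fixes A :: "('a, 'r) ring_scheme" and M :: "('a, 'u) module"
  assumes "finite (carrier A)"
  shows "M \<in> fg_mods A \<longleftrightarrow> right_module A M \<and> finite (carrier M)"
proof -
  have "finite (carrier M)" if M: "right_module A M" and fg: "fin_gen A M"
  proof -
    interpret right_module A M by fact
    obtain S where S: "finite S" "S \<subseteq> carrier M"
      and gen: "\<forall>x\<in>carrier M. \<exists>c\<in>S \<rightarrow> carrier A. x = (\<Oplus>\<^bsub>M\<^esub>s\<in>S. c s \<odot>\<^bsub>M\<^esub> s)"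
      using fg unfolding fin_gen_def by blast
    \<comment> \<open>The coefficient functions are cut down to extensional ones, of which there are
      finitely many.\<close>
    have "carrier M \<subseteq> (\<lambda>c. \<Oplus>\<^bsub>M\<^esub>s\<in>S. c s \<odot>\<^bsub>M\<^esub> s) ` (S \<rightarrow>\<^sub>E carrier A)"
    proof
      fix x assume "x \<in> carrier M"
      then obtain c where c: "c \<in> S \<rightarrow> carrier A" and x: "x = (\<Oplus>\<^bsub>M\<^esub>s\<in>S. c s \<odot>\<^bsub>M\<^esub> s)"
        using gen by blast
      have "x = (\<Oplus>\<^bsub>M\<^esub>s\<in>S. restrict c S s \<odot>\<^bsub>M\<^esub> s)"
        unfolding x using S c by (intro M.finsum_cong') (auto intro!: ract_closed)
      then show "x \<in> (\<lambda>c. \<Oplus>\<^bsub>M\<^esub>s\<in>S. c s \<odot>\<^bsub>M\<^esub> s) ` (S \<rightarrow>\<^sub>E carrier A)"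
        using c by (intro image_eqI[where x = "restrict c S"]) (auto simp: restrict_PiE_iff)
    qed
    moreover have "finite (S \<rightarrow>\<^sub>E carrier A)" using S assms by (intro finite_PiE) auto
    ultimately show ?thesis by (meson finite_surj)
  qed
  moreover have "fin_gen A M" if M: "right_module A M" and fin: "finite (carrier M)"
  proof -
    interpret right_module A M by fact
    show ?thesis unfolding fin_gen_def
    proof (intro exI[of _ "carrier M"] conjI fin order_refl ballI)
      fix x assume "x \<in> carrier M"
      then show "\<exists>c\<in>carrier M \<rightarrow> carrier A. x = (\<Oplus>\<^bsub>M\<^esub>s\<in>carrier M. c s \<odot>\<^bsub>M\<^esub> s)"
        using finsum_delta[OF fin, of x "\<lambda>s. s"]
        by (intro bexI[of _ "\<lambda>s. if x = s then \<one>\<^bsub>A\<^esub> else \<zero>\<^bsub>A\<^esub>"]) auto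
    qed
  qed
  ultimately show ?thesis unfolding fg_mods_def by blast
qed

text \<open>\<open>A\<close> as a right module over itself: scalars multiply on the right, although
  \<open>smult\<close> takes them as its first argument. Linear maps into it are the linear
  forms.\<close>

definition regular :: "('a, 'r) ring_scheme \<Rightarrow> ('a, 'a) module" where
  "regular A = \<lparr>carrier = carrier A, monoid.mult = monoid.mult A, one = one A, zero = zero A,
    add = add A, smult = \<lambda>a x. x \<otimes>\<^bsub>A\<^esub> a\<rparr>"

lemma regular_simps [simp]:
  "carrier (regular A) = carrier A" "\<zero>\<^bsub>regular A\<^esub> = \<zero>\<^bsub>A\<^esub>"
  "x \<oplus>\<^bsub>regular A\<^esub> y = x \<oplus>\<^bsub>A\<^esub> y" "a \<odot>\<^bsub>regular A\<^esub> x = x \<otimes>\<^bsub>A\<^esub> a"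
  by (simp_all add: regular_def)

text \<open>This is the form \<open>\<phi>\<close> followed by the linear map from \<open>A\<close>
  to \<open>N\<close> that sends 1 to \<open>m\<close>. Maps out of free modules, and later the
  extensions along \<open>u\<close>, are sums of such maps.\<close>

lemma lin_regular_ract:
  assumes "right_module A N" "lin A M (regular A) \<phi>" "m \<in> carrier N"
  shows "lin A M N (\<lambda>x. \<phi> x \<odot>\<^bsub>N\<^esub> m)"
proof -
  interpret N: right_module A N by fact
  show ?thesis using linD[OF assms(2)] assms(3)
    by (auto simp: lin_def N.ract_closed N.ract_ring_distr N.ract_mult)
qed

section \<open>Free modules of finite rank and their lifting property\<close>

text \<open>\<open>F\<close> is free of rank \<open>card I\<close>, described by its coordinate functions instead of a basis.\<close>

definition coordinates :: "('a, 'r) ring_scheme \<Rightarrow> ('a, 'u) module \<Rightarrow> 'i set \<Rightarrow> ('i \<Rightarrow> 'u \<Rightarrow> 'a) \<Rightarrow> bool" where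
  "coordinates A F I c \<longleftrightarrow> (\<forall>i\<in>I. lin A F (regular A) (c i)) \<and>
    (\<forall>v\<in>I \<rightarrow> carrier A. \<exists>x\<in>carrier F. \<forall>i\<in>I. c i x = v i) \<and>
    (\<forall>x\<in>carrier F. \<forall>y\<in>carrier F. (\<forall>i\<in>I. c i x = c i y) \<longrightarrow> x = y)"

text \<open>The functions from \<open>I\<close> to \<open>A\<close> form the free module, but in the
  wrong element type. Being finite, this module can be injected into the infinite type
  \<open>'u\<close>, and its structure is carried along.\<close>

lemma ex_coordinates:
  fixes A :: "('a, 'r) ring_scheme" and I :: "'i set"
  assumes A: "ring A" "finite (carrier A)" and I: "finite I"
  shows "\<exists>F :: ('a, 'u::infinite) module. \<exists>c. F \<in> fg_mods A \<and> coordinates A F I c"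
proof -
  interpret A: ring A by fact
  define V :: "('a, 'i \<Rightarrow> 'a) module" where
    "V = \<lparr>carrier = I \<rightarrow>\<^sub>E carrier A, monoid.mult = undefined, one = undefined,
      zero = \<lambda>i\<in>I. \<zero>\<^bsub>A\<^esub>, add = \<lambda>v w. \<lambda>i\<in>I. v i \<oplus>\<^bsub>A\<^esub> w i, smult = \<lambda>a v. \<lambda>i\<in>I. v i \<otimes>\<^bsub>A\<^esub> a\<rparr>"
  have fin: "finite (carrier V)" using A I by (simp add: V_def finite_PiE)
  have cl: "v i \<in> carrier A" if "v \<in> carrier V" "i \<in> I" for v i
    using that by (auto simp: V_def)
  have eqI: "v = w" if "v \<in> carrier V" "w \<in> carrier V" "\<And>i. i \<in> I \<Longrightarrow> v i = w i" for v w
    using that unfolding V_def by (auto intro: PiE_ext)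
  have [simp]: "(v \<oplus>\<^bsub>V\<^esub> w) i = v i \<oplus>\<^bsub>A\<^esub> w i" "\<zero>\<^bsub>V\<^esub> i = \<zero>\<^bsub>A\<^esub>" "(a \<odot>\<^bsub>V\<^esub> v) i = v i \<otimes>\<^bsub>A\<^esub> a"
    if "i \<in> I" for v w a i using that by (simp_all add: V_def)
  have ad: "v \<oplus>\<^bsub>V\<^esub> w \<in> carrier V" if "v \<in> carrier V" "w \<in> carrier V" for v w
    using that by (auto simp: V_def)
  have ze: "\<zero>\<^bsub>V\<^esub> \<in> carrier V" by (auto simp: V_def)
  have sm: "a \<odot>\<^bsub>V\<^esub> v \<in> carrier V" if "a \<in> carrier A" "v \<in> carrier V" for a v
    using that by (auto simp: V_def)
  have "\<exists>w\<in>carrier V. w \<oplus>\<^bsub>V\<^esub> v = \<zero>\<^bsub>V\<^esub>" if v: "v \<in> carrier V" for v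
  proof
    show w: "(\<lambda>i\<in>I. \<ominus>\<^bsub>A\<^esub> v i) \<in> carrier V" using cl[OF v] by (auto simp: V_def)
    show "(\<lambda>i\<in>I. \<ominus>\<^bsub>A\<^esub> v i) \<oplus>\<^bsub>V\<^esub> v = \<zero>\<^bsub>V\<^esub>"
      using cl[OF v] by (intro eqI ad w v ze) (simp add: A.l_neg)
  qed
  note inv = this
  have "abelian_group V"
  proof (rule abelian_groupI)
    show "u \<oplus>\<^bsub>V\<^esub> v \<oplus>\<^bsub>V\<^esub> w = u \<oplus>\<^bsub>V\<^esub> (v \<oplus>\<^bsub>V\<^esub> w)"
      if "u \<in> carrier V" "v \<in> carrier V" "w \<in> carrier V" for u v w
      using that by (intro eqI ad) (simp_all add: cl A.a_assoc)
    show "v \<oplus>\<^bsub>V\<^esub> w = w \<oplus>\<^bsub>V\<^esub> v" if "v \<in> carrier V" "w \<in> carrier V" for v w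
      using that by (intro eqI ad) (simp_all add: cl A.a_comm)
    show "\<zero>\<^bsub>V\<^esub> \<oplus>\<^bsub>V\<^esub> v = v" if "v \<in> carrier V" for v
      using that by (intro eqI ad ze) (simp_all add: cl)
  qed (use ad ze inv in auto)
  moreover have "right_module_axioms A V"
  proof
    show "a \<odot>\<^bsub>V\<^esub> v \<in> carrier V" if "a \<in> carrier A" "v \<in> carrier V" for a v
      using that by (rule sm)
    show "(a \<oplus>\<^bsub>A\<^esub> b) \<odot>\<^bsub>V\<^esub> v = a \<odot>\<^bsub>V\<^esub> v \<oplus>\<^bsub>V\<^esub> b \<odot>\<^bsub>V\<^esub> v"
      if "a \<in> carrier A" "b \<in> carrier A" "v \<in> carrier V" for a b v
      using that by (intro eqI ad sm) (simp_all add: cl A.r_distr)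
    show "a \<odot>\<^bsub>V\<^esub> (v \<oplus>\<^bsub>V\<^esub> w) = a \<odot>\<^bsub>V\<^esub> v \<oplus>\<^bsub>V\<^esub> a \<odot>\<^bsub>V\<^esub> w"
      if "a \<in> carrier A" "v \<in> carrier V" "w \<in> carrier V" for a v w
      using that by (intro eqI ad sm) (simp_all add: cl A.l_distr)
    show "(a \<otimes>\<^bsub>A\<^esub> b) \<odot>\<^bsub>V\<^esub> v = b \<odot>\<^bsub>V\<^esub> (a \<odot>\<^bsub>V\<^esub> v)"
      if "a \<in> carrier A" "b \<in> carrier A" "v \<in> carrier V" for a b v
      using that by (intro eqI sm) (simp_all add: cl A.m_assoc)
    show "\<one>\<^bsub>A\<^esub> \<odot>\<^bsub>V\<^esub> v = v" if "v \<in> carrier V" for v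
      using that by (intro eqI sm) (simp_all add: cl)
  qed
  ultimately have V: "right_module A V"
    unfolding right_module_def using A.ring_axioms by blast
  \<comment> \<open>An infinite type contains a set with as many elements as the finite carrier of
    \<open>V\<close>.\<close>
  obtain r :: "(('i \<Rightarrow> 'a)) \<Rightarrow> 'u" where r: "inj_on r (carrier V)"
  proof -
    obtain B :: "'u set" where "finite B" "card B = card (carrier V)"
      using infinite_arbitrarily_large[OF infinite_UNIV, of "card (carrier V)"] by blast
    then show ?thesis
      using that finite_same_card_bij[OF fin] by (metis bij_betw_imp_inj_on)
  qed
  have "\<exists>F :: ('a, 'u) module. right_module A F \<and> carrier F = r ` carrier V \<and> lin A V F r"
    by (rule ex_image_module[OF V]) (metis r inj_onD)+
  then obtain F :: "('a, 'u) module" where F: "right_module A F" "carrier F = r ` carrier V" "lin A V F r"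
    by blast
  \<comment> \<open>The coordinates of an element of \<open>F\<close> are the values of the function
    that it encodes.\<close>
  define c where "c = (\<lambda>i x. inv_into (carrier V) r x i)"
  have cr: "c i (r v) = v i" if "v \<in> carrier V" for i v
    unfolding c_def using r that by simp
  have "lin A F (regular A) (c i)" if i: "i \<in> I" for i
    unfolding lin_def F(2) using linD[OF F(3)] ad sm i
    by (auto simp: cr cl simp flip: linD(2,3)[OF F(3)])
  moreover have "\<exists>x\<in>carrier F. \<forall>i\<in>I. c i x = v i" if "v \<in> I \<rightarrow> carrier A" for v
  proof -
    have "restrict v I \<in> carrier V" using that by (auto simp: V_def)
    then show ?thesis unfolding F(2) by (intro bexI[of _ "r (restrict v I)"]) (auto simp: cr)
  qed
  moreover have "x = y" if "x \<in> carrier F" "y \<in> carrier F" "\<forall>i\<in>I. c i x = c i y" for x y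
  proof -
    obtain v w where v: "v \<in> carrier V" "x = r v" and w: "w \<in> carrier V" "y = r w"
      using \<open>x \<in> carrier F\<close> \<open>y \<in> carrier F\<close> unfolding F(2) by blast
    have "v = w" using that(3) by (intro eqI v w) (simp add: v w cr)
    then show ?thesis by (simp add: v w)
  qed
  ultimately have "coordinates A F I c" unfolding coordinates_def by blast
  moreover have "F \<in> fg_mods A" using F fin A by (simp add: fg_mods_iff_finite)
  ultimately show ?thesis by blast
qed

text \<open>Coordinates separate the elements of \<open>F\<close>, so \<open>x\<close> is the
  combination of the \<open>b i\<close> with coefficients \<open>c i x\<close> as soon as all
  coordinates agree; applying \<open>h\<close> gives the formula. A linear map on \<open>F\<close>
  is thus known from its values on the basis.\<close>

lemma coordinates_expand:
  fixes F :: "('a, 'u) module" and N :: "('a, 'v, 's) module_scheme"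
  assumes c: "coordinates A F I c" and F: "right_module A F" and I: "finite I"
    and N: "right_module A N" and h: "lin A F N h" and x: "x \<in> carrier F"
    and b: "b \<in> I \<rightarrow> carrier F" "\<And>i k. i \<in> I \<Longrightarrow> k \<in> I \<Longrightarrow> c k (b i) = (if k = i then \<one>\<^bsub>A\<^esub> else \<zero>\<^bsub>A\<^esub>)"
  shows "h x = (\<Oplus>\<^bsub>N\<^esub>i\<in>I. c i x \<odot>\<^bsub>N\<^esub> h (b i))"
proof -
  interpret F: right_module A F by fact
  interpret N: right_module A N by fact
  have ci: "lin A F (regular A) (c i)" if "i \<in> I" for i using c that by (simp add: coordinates_def)
  \<comment> \<open>Comparing coordinates means moving \<open>c k\<close> through a sum, which takes
    place in the module \<open>regular A\<close> afterwards.\<close>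
  have reg: "right_module A (regular A)"
  proof -
    have "abelian_group (regular A)"
      by (rule abelian_groupI) (auto simp: F.A.a_ac intro: F.A.l_neg F.A.a_inv_closed bexI[of _ "\<ominus>\<^bsub>A\<^esub> _"])
    then show ?thesis
      unfolding right_module_def right_module_axioms_def
      by (auto simp: F.A.ring_axioms F.A.l_distr F.A.r_distr F.A.m_assoc)
  qed
  interpret A: right_module A "regular A" by fact
  have cx: "c i x \<in> carrier A" if "i \<in> I" for i using linD(1)[OF ci[OF that] x] by simp
  have f: "(\<lambda>i. c i x \<odot>\<^bsub>F\<^esub> b i) \<in> I \<rightarrow> carrier F" using b(1) cx by (auto intro!: F.ract_closed)
  have "x = (\<Oplus>\<^bsub>F\<^esub>i\<in>I. c i x \<odot>\<^bsub>F\<^esub> b i)"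
  proof -
    have "c k x = c k (\<Oplus>\<^bsub>F\<^esub>i\<in>I. c i x \<odot>\<^bsub>F\<^esub> b i)" if k: "k \<in> I" for k
    proof -
      have "c k (\<Oplus>\<^bsub>F\<^esub>i\<in>I. c i x \<odot>\<^bsub>F\<^esub> b i) = (\<Oplus>\<^bsub>regular A\<^esub>i\<in>I. c k (c i x \<odot>\<^bsub>F\<^esub> b i))"
        by (rule lin_of_finsum[OF F reg ci[OF k] I f])
      also have "\<dots> = (\<Oplus>\<^bsub>regular A\<^esub>i\<in>I. if k = i then c i x else \<zero>\<^bsub>regular A\<^esub>)"
        using k cx b linD(3)[OF ci[OF k]] by (intro A.M.finsum_cong') (auto simp: Pi_iff)
      also have "\<dots> = c k x" using cx by (intro A.M.finsum_singleton[OF k I]) auto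
      finally show ?thesis by simp
    qed
    then show ?thesis using c x F.M.finsum_closed[OF f] unfolding coordinates_def by blast
  qed
  then have "h x = (\<Oplus>\<^bsub>N\<^esub>i\<in>I. h (c i x \<odot>\<^bsub>F\<^esub> b i))"
    using lin_of_finsum[OF F N h I f] by simp
  also have "\<dots> = (\<Oplus>\<^bsub>N\<^esub>i\<in>I. c i x \<odot>\<^bsub>N\<^esub> h (b i))"
    using b(1) cx linD[OF h]
    by (intro N.M.finsum_cong') (auto simp: Pi_iff intro!: N.ract_closed)
  finally show ?thesis .
qed

lemma coordinates_basis:
  assumes "ring A" "coordinates A F I c"
  obtains b where "b \<in> I \<rightarrow> carrier F"
    "\<And>i k. i \<in> I \<Longrightarrow> k \<in> I \<Longrightarrow> c k (b i) = (if k = i then \<one>\<^bsub>A\<^esub> else \<zero>\<^bsub>A\<^esub>)"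
proof -
  interpret ring A by fact
  \<comment> \<open>For \<open>i\<close> outside \<open>I\<close> the vector asked for is zero, so
    the claim holds for every \<open>i\<close> and a total choice is possible.\<close>
  have "\<exists>x\<in>carrier F. \<forall>k\<in>I. c k x = (if k = i then \<one>\<^bsub>A\<^esub> else \<zero>\<^bsub>A\<^esub>)" for i
    using assms(2) unfolding coordinates_def by (simp add: Pi_iff)
  then have "\<forall>i. \<exists>x. x \<in> carrier F \<and> (\<forall>k\<in>I. c k x = (if k = i then \<one>\<^bsub>A\<^esub> else \<zero>\<^bsub>A\<^esub>))" by blast
  then obtain b where "\<forall>i. b i \<in> carrier F \<and> (\<forall>k\<in>I. c k (b i) = (if k = i then \<one>\<^bsub>A\<^esub> else \<zero>\<^bsub>A\<^esub>))"
    by metis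
  then show ?thesis by (intro that[of b]) auto
qed

lemma coordinates_lin:
  assumes "coordinates A F I c" "right_module A F" "finite I" "right_module A N" "m \<in> I \<rightarrow> carrier N"
  shows "lin A F N (\<lambda>x. \<Oplus>\<^bsub>N\<^esub>i\<in>I. c i x \<odot>\<^bsub>N\<^esub> m i)"
proof (rule lin_finsum[OF assms(4,3) _ assms(2)])
  show "lin A F N (\<lambda>x. c i x \<odot>\<^bsub>N\<^esub> m i)" if "i \<in> I" for i
    using assms(1,5) that by (intro lin_regular_ract[OF assms(4)]) (auto simp: coordinates_def)
qed

text \<open>The images \<open>h (b i)\<close> of a basis are lifted one by one through the
  surjection \<open>g\<close>, and the lifts are extended linearly;
  \<open>coordinates_expand\<close> shows that this extension lifts \<open>h\<close>
  everywhere.\<close>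

lemma coordinates_projective:
  fixes F :: "('a, 'u) module"
  assumes c: "coordinates A F I c" and F: "right_module A F" and I: "finite I"
  shows "projective A F"
  unfolding projective_def
proof (intro conjI F allI impI, elim conjE)
  fix M N :: "('a, 'u) module" and g h
  assume M: "right_module A M" and N: "right_module A N" and g: "g \<in> rhom A M N"
    and surj: "g ` carrier M = carrier N" and h: "h \<in> rhom A F N"
  interpret F: right_module A F by fact
  interpret N: right_module A N by fact
  interpret M: right_module A M by fact
  have gl: "lin A M N g" and hl: "lin A F N h" using g h by (simp_all add: rhom_iff)
  obtain b where b: "b \<in> I \<rightarrow> carrier F"
    "\<And>i k. i \<in> I \<Longrightarrow> k \<in> I \<Longrightarrow> c k (b i) = (if k = i then \<one>\<^bsub>A\<^esub> else \<zero>\<^bsub>A\<^esub>)"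
    using coordinates_basis[OF F.A.ring_axioms c] by blast
  define m where "m = (\<lambda>i. inv_into (carrier M) g (h (b i)))"
  have m: "\<forall>i\<in>I. m i \<in> carrier M \<and> g (m i) = h (b i)"
  proof
    fix i assume "i \<in> I"
    then have "h (b i) \<in> g ` carrier M" unfolding surj using b(1) by (intro linD(1)[OF hl]) auto
    then show "m i \<in> carrier M \<and> g (m i) = h (b i)"
      unfolding m_def by (blast intro: inv_into_into f_inv_into_f)
  qed
  define k where "k = (\<lambda>x. \<Oplus>\<^bsub>M\<^esub>i\<in>I. c i x \<odot>\<^bsub>M\<^esub> m i)"
  have k: "lin A F M k" unfolding k_def using m by (intro coordinates_lin[OF c F I M]) auto
  have "g (k x) = h x" if x: "x \<in> carrier F" for x
  proof -
    have cx: "c i x \<in> carrier A" if "i \<in> I" for i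
      using c x that by (auto simp: coordinates_def lin_def)
    have "g (k x) = (\<Oplus>\<^bsub>N\<^esub>i\<in>I. g (c i x \<odot>\<^bsub>M\<^esub> m i))"
      unfolding k_def using m cx by (intro lin_of_finsum[OF M N gl I]) (auto intro!: M.ract_closed)
    also have "\<dots> = (\<Oplus>\<^bsub>N\<^esub>i\<in>I. c i x \<odot>\<^bsub>N\<^esub> h (b i))"
      using m cx linD[OF gl] linD[OF hl] b(1)
      by (intro N.M.finsum_cong') (auto simp: Pi_iff intro!: N.ract_closed)
    also have "\<dots> = h x" using coordinates_expand[OF c F I N hl x b] by simp
    finally show ?thesis .
  qed
  then have "compose (carrier F) g (restrict k (carrier F)) = h"
    using h by (intro extensionalityI[of _ "carrier F"]) (auto simp: compose_def rhom_iff)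
  with rhom_restrict[OF F k] show "\<exists>k\<in>rhom A F M. compose (carrier F) g k = h" by blast
qed

text \<open>The lifting property is stated for extensional maps; restricting \<open>g\<close> and
  \<open>h\<close> to their carriers makes it available for \<open>lin\<close>, with a pointwise
  equation.\<close>

lemma projective_lift:
  fixes P M N :: "('a, 'u) module"
  assumes P: "projective A P" and M: "right_module A M" and N: "right_module A N"
    and g: "lin A M N g" "g ` carrier M = carrier N" and h: "lin A P N h"
  obtains k where "lin A P M k" "\<And>x. x \<in> carrier P \<Longrightarrow> g (k x) = h x"
proof -
  have P': "right_module A P" using P by (simp add: projective_def)
  have r: "restrict g (carrier M) \<in> rhom A M N" "restrict g (carrier M) ` carrier M = carrier N"
    "restrict h (carrier P) \<in> rhom A P N"
    using rhom_restrict[OF M g(1)] rhom_restrict[OF P' h] g(2) by auto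
  then obtain k where k: "k \<in> rhom A P M"
    and eq: "compose (carrier P) (restrict g (carrier M)) k = restrict h (carrier P)"
    using P M N unfolding projective_def by meson
  have kl: "lin A P M k" using k by (simp add: rhom_iff)
  moreover have "g (k x) = h x" if "x \<in> carrier P" for x
    using fun_cong[OF eq, of x] that linD(1)[OF kl that] by (simp add: compose_def)
  ultimately show ?thesis using that by blast
qed

text \<open>The free module \<open>F\<close> has one basis vector for each element of
  \<open>P\<close> and maps onto \<open>P\<close> by sending the vector to that element.
  Projectivity splits this map, and the coordinates of the splitting are the forms
  \<open>\<phi> i\<close>.\<close>

lemma dual_basis:
  fixes P :: "('a, 'u::infinite) module"
  assumes A: "ring A" "finite (carrier A)" and P: "projective A P" "P \<in> fg_mods A"
  obtains \<phi> where "\<And>i. i \<in> carrier P \<Longrightarrow> lin A P (regular A) (\<phi> i)"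
    "\<And>x. x \<in> carrier P \<Longrightarrow> x = (\<Oplus>\<^bsub>P\<^esub>i\<in>carrier P. \<phi> i x \<odot>\<^bsub>P\<^esub> i)"
proof -
  have fin: "finite (carrier P)" and P': "right_module A P"
    using P A by (simp_all add: fg_mods_iff_finite)
  interpret P: right_module A P by fact
  obtain F :: "('a, 'u) module" and c where F: "F \<in> fg_mods A" and c: "coordinates A F (carrier P) c"
    using ex_coordinates[OF A fin] by blast
  have F': "right_module A F" using F by (simp add: fg_mods_def)
  define e where "e = (\<lambda>x. \<Oplus>\<^bsub>P\<^esub>i\<in>carrier P. c i x \<odot>\<^bsub>P\<^esub> i)"
  have e: "lin A F P e" unfolding e_def by (rule coordinates_lin[OF c F' fin P']) auto
  obtain b where b: "b \<in> carrier P \<rightarrow> carrier F"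
    "\<And>i k. i \<in> carrier P \<Longrightarrow> k \<in> carrier P \<Longrightarrow> c k (b i) = (if k = i then \<one>\<^bsub>A\<^esub> else \<zero>\<^bsub>A\<^esub>)"
    using coordinates_basis[OF A(1) c] by blast
  have "e (b k) = k" if k: "k \<in> carrier P" for k
  proof -
    have "e (b k) = (\<Oplus>\<^bsub>P\<^esub>i\<in>carrier P. (if k = i then \<one>\<^bsub>A\<^esub> else \<zero>\<^bsub>A\<^esub>) \<odot>\<^bsub>P\<^esub> i)"
      unfolding e_def using b k by (intro P.M.finsum_cong') (auto intro!: P.ract_closed)
    then show ?thesis using P.finsum_delta[OF fin k, of "\<lambda>i. i"] by simp
  qed
  then have "e ` carrier F = carrier P" using linD(1)[OF e] b(1) by (force simp: Pi_iff image_iff)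
  then obtain s where s: "lin A P F s" "\<And>x. x \<in> carrier P \<Longrightarrow> e (s x) = x"
    using projective_lift[OF P(1) F' P' e _ lin_id] by metis
  show ?thesis
  proof (rule that[of "\<lambda>i x. c i (s x)"])
    show "lin A P (regular A) (\<lambda>x. c i (s x))" if "i \<in> carrier P" for i
      using c that by (intro lin_compose[OF s(1)]) (auto simp: coordinates_def)
    show "x = (\<Oplus>\<^bsub>P\<^esub>i\<in>carrier P. c i (s x) \<odot>\<^bsub>P\<^esub> i)" if "x \<in> carrier P" for x
      using s(2)[OF that] by (simp add: e_def)
  qed
qed

text \<open>All linear forms on \<open>X\<close> together give the map from \<open>X\<close> to a free module.\<close>

lemma left_projective_approximation:
  fixes X :: "('a, 'u::infinite) module"
  assumes A: "ring A" "finite (carrier A)" and X: "X \<in> fg_mods A"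
  obtains Q :: "('a, 'u) module" and u where "Q \<in> fg_mods A" "projective A Q" "lin A X Q u"
    "\<forall>P :: ('a, 'u) module. \<forall>g. P \<in> fg_mods A \<longrightarrow> projective A P \<longrightarrow> lin A X P g \<longrightarrow>
      (\<exists>e. lin A Q P e \<and> (\<forall>x\<in>carrier X. e (u x) = g x))"
proof -
  have fin: "finite (carrier X)" and X': "right_module A X"
    using X A by (simp_all add: fg_mods_iff_finite)
  interpret X: right_module A X by fact
  \<comment> \<open>Extensional functions keep this set finite while every linear form on
    \<open>X\<close> is still represented.\<close>
  define I where "I = {h \<in> carrier X \<rightarrow>\<^sub>E carrier A. lin A X (regular A) h}"
  have finI: "finite I" unfolding I_def using A fin by (simp add: finite_PiE)
  obtain Q :: "('a, 'u) module" and c where Q: "Q \<in> fg_mods A" and c: "coordinates A Q I c"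
    using ex_coordinates[OF A finI] by blast
  have Q': "right_module A Q" using Q by (simp add: fg_mods_def)
  interpret Q: right_module A Q by fact
  have Il: "lin A X (regular A) h" if "h \<in> I" for h using that by (simp add: I_def)
  have cl: "lin A Q (regular A) (c h)" if "h \<in> I" for h using that c by (simp add: coordinates_def)
  have inj: "x = y" if "x \<in> carrier Q" "y \<in> carrier Q" "\<forall>h\<in>I. c h x = c h y" for x y
    using that c by (simp add: coordinates_def)
  \<comment> \<open>The map \<open>u\<close> is evaluation: the coordinate of \<open>u x\<close>
    with index \<open>h\<close> is \<open>h x\<close>.\<close>
  have "\<exists>y\<in>carrier Q. \<forall>h\<in>I. c h y = h x" if x: "x \<in> carrier X" for x
  proof -
    have "(\<lambda>h. h x) \<in> I \<rightarrow> carrier A" using linD(1)[OF Il x] by auto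
    then show ?thesis using c by (simp add: coordinates_def)
  qed
  then obtain u where u: "\<And>x. x \<in> carrier X \<Longrightarrow> u x \<in> carrier Q"
    "\<And>x h. x \<in> carrier X \<Longrightarrow> h \<in> I \<Longrightarrow> c h (u x) = h x" by metis
  have ul: "lin A X Q u" unfolding lin_def
  proof (intro conjI ballI)
    show "u (x \<oplus>\<^bsub>X\<^esub> y) = u x \<oplus>\<^bsub>Q\<^esub> u y" if "x \<in> carrier X" "y \<in> carrier X" for x y
      using that linD(2)[OF Il] linD(2)[OF cl] by (intro inj) (auto simp: u)
    show "u (a \<odot>\<^bsub>X\<^esub> x) = a \<odot>\<^bsub>Q\<^esub> u x" if "a \<in> carrier A" "x \<in> carrier X" for a x
      using that linD(3)[OF Il] linD(3)[OF cl] by (intro inj) (auto simp: u X.ract_closed Q.ract_closed)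
  qed (use u in auto)
  show ?thesis
  proof (rule that[OF Q _ ul])
    show "projective A Q" by (rule coordinates_projective[OF c Q' finI])
  next
    show "\<forall>P :: ('a, 'u) module. \<forall>g. P \<in> fg_mods A \<longrightarrow> projective A P \<longrightarrow> lin A X P g \<longrightarrow>
        (\<exists>e. lin A Q P e \<and> (\<forall>x\<in>carrier X. e (u x) = g x))"
    proof (intro allI impI)
      fix P :: "('a, 'u) module" and g
      assume P: "P \<in> fg_mods A" "projective A P" and g: "lin A X P g"
      have finP: "finite (carrier P)" and P': "right_module A P"
        using P A by (simp_all add: fg_mods_iff_finite)
      obtain \<phi> where \<phi>: "\<And>i. i \<in> carrier P \<Longrightarrow> lin A P (regular A) (\<phi> i)"
        "\<And>x. x \<in> carrier P \<Longrightarrow> x = (\<Oplus>\<^bsub>P\<^esub>i\<in>carrier P. \<phi> i x \<odot>\<^bsub>P\<^esub> i)"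
        using dual_basis[OF A P(2,1)] by blast
      interpret P: right_module A P by fact
      \<comment> \<open>The dual basis writes \<open>g x\<close> as the sum of the elements
        \<open>i\<close> with coefficients \<open>\<phi> i (g x)\<close>. Each coefficient is a
        linear form in \<open>x\<close>, hence one of the indices in \<open>I\<close>.\<close>
      define \<psi> where "\<psi> = (\<lambda>i. \<lambda>x\<in>carrier X. \<phi> i (g x))"
      have l: "lin A X (regular A) (\<lambda>x. \<phi> i (g x))" if "i \<in> carrier P" for i
        by (rule lin_compose[OF g \<phi>(1)[OF that]])
      have \<psi>: "\<psi> i \<in> I" if "i \<in> carrier P" for i
        using lin_restrict[OF X' l[OF that]] linD(1)[OF l[OF that]]
        by (auto simp: \<psi>_def I_def)
      \<comment> \<open>The form \<open>\<psi> i\<close> is replaced by the coordinate of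
        \<open>Q\<close> that it indexes. At \<open>u x\<close> this coordinate has the value
        \<open>\<psi> i x\<close>, so the sum becomes \<open>g x\<close>.\<close>
      define e where "e = (\<lambda>y. \<Oplus>\<^bsub>P\<^esub>i\<in>carrier P. c (\<psi> i) y \<odot>\<^bsub>P\<^esub> i)"
      have "lin A Q P e"
        unfolding e_def by (intro lin_finsum lin_regular_ract P' finP Q' cl \<psi>)
      moreover have "e (u x) = g x" if x: "x \<in> carrier X" for x
      proof -
        have "e (u x) = (\<Oplus>\<^bsub>P\<^esub>i\<in>carrier P. \<phi> i (g x) \<odot>\<^bsub>P\<^esub> i)"
          unfolding e_def using x \<psi> u linD(1)[OF l x]
          by (intro P.M.finsum_cong') (auto simp: \<psi>_def intro!: P.ract_closed)
        then show ?thesis using \<phi>(2)[OF linD(1)[OF g x]] by simp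
      qed
      ultimately show "\<exists>e. lin A Q P e \<and> (\<forall>x\<in>carrier X. e (u x) = g x)" by blast
    qed
  qed
qed

section \<open>Cokernels, and maps out of quotients and into kernels\<close>

text \<open>The elements of the cokernel are representatives picked inside \<open>Q\<close>, so the
  quotient stays in the type and its carrier is finite along with that of \<open>Q\<close>.\<close>

lemma cokernel:
  fixes X Q :: "('a, 'u) module"
  assumes fin: "finite (carrier A)" and X: "right_module A X" and Q: "Q \<in> fg_mods A" and u: "lin A X Q u"
  obtains C :: "('a, 'u) module" and c where "C \<in> fg_mods A" "lin A Q C c" "c ` carrier Q = carrier C"
    "\<And>y. y \<in> carrier Q \<Longrightarrow> c y = \<zero>\<^bsub>C\<^esub> \<longleftrightarrow> y \<in> u ` carrier X"
proof -
  have Q': "right_module A Q" and finQ: "finite (carrier Q)" using Q fin by (simp_all add: fg_mods_iff_finite)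
  interpret X: right_module A X by fact
  interpret Q: right_module A Q by fact
  define U where "U = u ` carrier X"
  have U: "\<zero>\<^bsub>Q\<^esub> \<in> U" "\<And>x y. x \<in> U \<Longrightarrow> y \<in> U \<Longrightarrow> x \<oplus>\<^bsub>Q\<^esub> y \<in> U" "\<And>x y. x \<in> U \<Longrightarrow> y \<in> U \<Longrightarrow> x \<ominus>\<^bsub>Q\<^esub> y \<in> U"
    "\<And>a x. a \<in> carrier A \<Longrightarrow> x \<in> U \<Longrightarrow> a \<odot>\<^bsub>Q\<^esub> x \<in> U" "U \<subseteq> carrier Q"
    unfolding U_def using linD[OF u] lin_zero_arg[OF X Q' u] lin_minus_arg[OF X Q' u] X.ract_closed
    by (auto simp flip: linD(2,3)[OF u] lin_zero_arg[OF X Q' u] lin_minus_arg[OF X Q' u])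
  define R where "R = (\<lambda>x y. x \<in> carrier Q \<and> y \<in> carrier Q \<and> x \<ominus>\<^bsub>Q\<^esub> y \<in> U)"
  have R_refl: "R x x" if "x \<in> carrier Q" for x
    using that U(1) by (simp add: R_def Q.M.minus_eq Q.M.r_neg)
  have R_sym: "R y x" if "R x y" for x y
  proof -
    have "y \<ominus>\<^bsub>Q\<^esub> x = \<zero>\<^bsub>Q\<^esub> \<ominus>\<^bsub>Q\<^esub> (x \<ominus>\<^bsub>Q\<^esub> y)"
      using that by (simp add: R_def Q.M.minus_eq Q.M.minus_add Q.M.a_comm)
    then show ?thesis using that U by (auto simp: R_def)
  qed
  have R_trans: "R x z" if "R x y" "R y z" for x y z
  proof -
    have "x \<ominus>\<^bsub>Q\<^esub> z = (x \<ominus>\<^bsub>Q\<^esub> y) \<oplus>\<^bsub>Q\<^esub> (y \<ominus>\<^bsub>Q\<^esub> z)"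
      using that by (simp add: R_def Q.M.minus_eq Q.M.a_assoc)
        (metis Q.M.a_assoc Q.M.a_inv_closed Q.M.l_neg Q.M.l_zero)
    then show ?thesis using that U by (auto simp: R_def)
  qed
  \<comment> \<open>The choice depends on \<open>x\<close> only through the predicate
    \<open>R x\<close>, which is the same throughout a coset; so equivalent elements get the same
    representative.\<close>
  define r where "r = (\<lambda>x. SOME y. R x y)"
  have r: "R x (r x)" if "x \<in> carrier Q" for x
    unfolding r_def using R_refl[OF that] by (rule someI)
  have r_eq: "r x = r y \<longleftrightarrow> R x y" if "x \<in> carrier Q" "y \<in> carrier Q" for x y
  proof
    assume "r x = r y"
    then show "R x y" using r[OF that(1)] r[OF that(2)] R_sym R_trans by metis
  next
    assume "R x y"
    then have "R x = R y" using R_sym R_trans by blast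
    then show "r x = r y" by (simp add: r_def)
  qed
  have "\<exists>C :: ('a, 'u) module. right_module A C \<and> carrier C = r ` carrier Q \<and> lin A Q C r"
  proof (rule ex_image_module[OF Q'])
    fix x x' y y' assume *: "x \<in> carrier Q" "x' \<in> carrier Q" "y \<in> carrier Q" "y' \<in> carrier Q" "r x = r x'" "r y = r y'"
    have "(x \<oplus>\<^bsub>Q\<^esub> y) \<ominus>\<^bsub>Q\<^esub> (x' \<oplus>\<^bsub>Q\<^esub> y') = (x \<ominus>\<^bsub>Q\<^esub> x') \<oplus>\<^bsub>Q\<^esub> (y \<ominus>\<^bsub>Q\<^esub> y')"
      using * by (simp add: Q.M.minus_eq Q.M.minus_add Q.M.a_ac)
    then show "r (x \<oplus>\<^bsub>Q\<^esub> y) = r (x' \<oplus>\<^bsub>Q\<^esub> y')"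
      using * U(2) by (simp add: r_eq) (simp add: R_def)
  next
    fix a x x' assume *: "a \<in> carrier A" "x \<in> carrier Q" "x' \<in> carrier Q" "r x = r x'"
    then have "a \<odot>\<^bsub>Q\<^esub> x \<ominus>\<^bsub>Q\<^esub> a \<odot>\<^bsub>Q\<^esub> x' = a \<odot>\<^bsub>Q\<^esub> (x \<ominus>\<^bsub>Q\<^esub> x')" by (simp add: Q.ract_minus)
    then show "r (a \<odot>\<^bsub>Q\<^esub> x) = r (a \<odot>\<^bsub>Q\<^esub> x')"
      using * U(4) by (simp add: r_eq Q.ract_closed) (simp add: R_def Q.ract_closed)
  qed
  then obtain C :: "('a, 'u) module" where C: "right_module A C" "carrier C = r ` carrier Q" "lin A Q C r"
    by blast
  have "r y = \<zero>\<^bsub>C\<^esub> \<longleftrightarrow> y \<in> U" if "y \<in> carrier Q" for y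
    using that lin_zero_arg[OF Q' C(1,3)] r_eq[OF that, of "\<zero>\<^bsub>Q\<^esub>"] by (simp add: R_def Q.M.minus_zero_right)
  moreover have "C \<in> fg_mods A" using C finQ fin by (simp add: fg_mods_iff_finite)
  ultimately show ?thesis using C unfolding U_def by (intro that[of C r]) auto
qed

text \<open>Two preimages under \<open>c\<close> differ by an element of its kernel, on which
  \<open>f\<close> vanishes; evaluating \<open>f\<close> at any chosen preimage is therefore well
  defined.\<close>

lemma factor_through_surj:
  assumes Q: "right_module A Q" and C: "right_module A C" and Z: "right_module A Z"
    and c: "lin A Q C c" "c ` carrier Q = carrier C" and f: "lin A Q Z f"
    and ker: "\<And>y. y \<in> carrier Q \<Longrightarrow> c y = \<zero>\<^bsub>C\<^esub> \<Longrightarrow> f y = \<zero>\<^bsub>Z\<^esub>"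
  obtains t where "lin A C Z t" "\<And>y. y \<in> carrier Q \<Longrightarrow> t (c y) = f y"
proof -
  interpret Q: right_module A Q by fact
  interpret C: right_module A C by fact
  interpret Z: right_module A Z by fact
  have eq: "f x = f y" if "x \<in> carrier Q" "y \<in> carrier Q" "c x = c y" for x y
  proof -
    have "c (x \<ominus>\<^bsub>Q\<^esub> y) = \<zero>\<^bsub>C\<^esub>"
      using that linD(1)[OF c(1)] by (simp add: lin_minus_arg[OF Q C c(1)] C.M.minus_eq C.M.r_neg)
    then have "f x \<ominus>\<^bsub>Z\<^esub> f y = \<zero>\<^bsub>Z\<^esub>"
      using ker[of "x \<ominus>\<^bsub>Q\<^esub> y"] that by (simp add: lin_minus_arg[OF Q Z f])
    then show ?thesis using that linD(1)[OF f] by (simp add: Z.M.minus_eq_zero_iff)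
  qed
  define t where "t = (\<lambda>z. f (inv_into (carrier Q) c z))"
  have t: "t (c y) = f y" if "y \<in> carrier Q" for y
    unfolding t_def using that by (intro eq) (auto intro: inv_into_into f_inv_into_f)
  have "lin A C Z t"
    unfolding lin_def using linD[OF f] linD(2,3)[OF c(1), symmetric] 
    by (auto simp: t Q.ract_closed simp flip: c(2))
  then show ?thesis using that t by blast
qed

text \<open>The injection \<open>i\<close> is inverted on its image, and linearity of the result is
  checked after applying \<open>i\<close>.\<close>

lemma lift_to_kernel:
  assumes K: "right_module A K" and P: "right_module A P" and Z: "right_module A Z"
    and i: "lin A K P i" "inj_on i (carrier K)" and f: "lin A Z P f"
    and im: "\<And>z. z \<in> carrier Z \<Longrightarrow> f z \<in> i ` carrier K"
  obtains s where "lin A Z K s" "\<And>z. z \<in> carrier Z \<Longrightarrow> i (s z) = f z"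
proof -
  interpret K: right_module A K by fact
  interpret Z: right_module A Z by fact
  define s where "s = (\<lambda>z. inv_into (carrier K) i (f z))"
  have s: "s z \<in> carrier K \<and> i (s z) = f z" if "z \<in> carrier Z" for z
    unfolding s_def using im[OF that] by (blast intro: inv_into_into f_inv_into_f)
  have inj: "x = y" if "i x = i y" "x \<in> carrier K" "y \<in> carrier K" for x y
    using that i(2) by (meson inj_onD)
  have "lin A Z K s"
    unfolding lin_def
  proof (intro conjI ballI)
    show "s (x \<oplus>\<^bsub>Z\<^esub> y) = s x \<oplus>\<^bsub>K\<^esub> s y" if "x \<in> carrier Z" "y \<in> carrier Z" for x y
      using that s linD(2)[OF i(1)] linD(2)[OF f] by (intro inj) simp_all
    show "s (a \<odot>\<^bsub>Z\<^esub> x) = a \<odot>\<^bsub>K\<^esub> s x" if "a \<in> carrier A" "x \<in> carrier Z" for a x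
      using that s linD(3)[OF i(1)] linD(3)[OF f]
      by (intro inj) (simp_all add: K.ract_closed Z.ract_closed)
  qed (use s in auto)
  then show ?thesis using that s by blast
qed

subsection \<open>Adjoints from universal arrows\<close>

text \<open>The bijection on hom sets is transposition: \<open>h\<close> goes to its image under
  \<open>G\<close> composed with the universal arrow \<open>\<eta>\<close>. The left adjoint on
  morphisms, and its functor laws, are forced because a map is determined by its transpose.\<close>

lemma left_adjoint_of_universal_arrows:
  assumes G: "is_functor C D G"
    and univ: "\<And>X. X \<in> Ob D \<Longrightarrow> \<exists>K\<in>Ob C. \<exists>\<eta>\<in>Hom D X (FOb G K).
      \<forall>Y\<in>Ob C. \<forall>g\<in>Hom D X (FOb G Y). \<exists>!h. h \<in> Hom C K Y \<and>
        Comp D X (FOb G K) (FOb G Y) (FHom G K Y h) \<eta> = g"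
  shows "has_left_adjoint C D G"
proof -
  interpret C: category C using G by (simp add: is_functor_def)
  interpret D: category D using G by (simp add: is_functor_def)
  have GO: "FOb G X \<in> Ob D" if "X \<in> Ob C" for X
    using G that by (simp add: is_functor_def)
  have GH: "FHom G X Y h \<in> Hom D (FOb G X) (FOb G Y)" if "X \<in> Ob C" "Y \<in> Ob C" "h \<in> Hom C X Y" for X Y h
    using G that by (simp add: is_functor_def)
  have GI: "FHom G X X (Idn C X) = Idn D (FOb G X)" if "X \<in> Ob C" for X
    using G that by (simp add: is_functor_def)
  have GC: "FHom G X Z (Comp C X Y Z g h) =
      Comp D (FOb G X) (FOb G Y) (FOb G Z) (FHom G Y Z g) (FHom G X Y h)"
    if "X \<in> Ob C" "Y \<in> Ob C" "Z \<in> Ob C" "h \<in> Hom C X Y" "g \<in> Hom C Y Z" for X Y Z g h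
    using G that by (simp add: is_functor_def)
  obtain L \<eta> where L: "\<And>X. X \<in> Ob D \<Longrightarrow> L X \<in> Ob C"
    and \<eta>: "\<And>X. X \<in> Ob D \<Longrightarrow> \<eta> X \<in> Hom D X (FOb G (L X))"
    and ex1: "\<And>X Y g. \<lbrakk>X \<in> Ob D; Y \<in> Ob C; g \<in> Hom D X (FOb G Y)\<rbrakk> \<Longrightarrow>
      \<exists>!h. h \<in> Hom C (L X) Y \<and> Comp D X (FOb G (L X)) (FOb G Y) (FHom G (L X) Y h) (\<eta> X) = g"
  proof -
    have "\<forall>X\<in>Ob D. \<exists>K. \<exists>\<eta>. K \<in> Ob C \<and> \<eta> \<in> Hom D X (FOb G K) \<and>
      (\<forall>Y\<in>Ob C. \<forall>g\<in>Hom D X (FOb G Y). \<exists>!h. h \<in> Hom C K Y \<and>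
        Comp D X (FOb G K) (FOb G Y) (FHom G K Y h) \<eta> = g)"
      using univ by blast
    from bchoice[OF this] obtain L where "\<forall>X\<in>Ob D. \<exists>\<eta>. L X \<in> Ob C \<and> \<eta> \<in> Hom D X (FOb G (L X)) \<and>
      (\<forall>Y\<in>Ob C. \<forall>g\<in>Hom D X (FOb G Y). \<exists>!h. h \<in> Hom C (L X) Y \<and>
        Comp D X (FOb G (L X)) (FOb G Y) (FHom G (L X) Y h) \<eta> = g)" by blast
    from bchoice[OF this] obtain \<eta> where "\<forall>X\<in>Ob D. L X \<in> Ob C \<and> \<eta> X \<in> Hom D X (FOb G (L X)) \<and>
      (\<forall>Y\<in>Ob C. \<forall>g\<in>Hom D X (FOb G Y). \<exists>!h. h \<in> Hom C (L X) Y \<and>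
        Comp D X (FOb G (L X)) (FOb G Y) (FHom G (L X) Y h) (\<eta> X) = g)" by blast
    then show ?thesis by (intro that[of L \<eta>]) blast+
  qed
  define \<phi> where "\<phi> = (\<lambda>X Y h. Comp D X (FOb G (L X)) (FOb G Y) (FHom G (L X) Y h) (\<eta> X))"
  have \<phi>_in: "\<phi> X Y h \<in> Hom D X (FOb G Y)" if "X \<in> Ob D" "Y \<in> Ob C" "h \<in> Hom C (L X) Y" for X Y h
    unfolding \<phi>_def using that by (intro D.Comp_closed[OF _ _ _ \<eta> GH] GO L) auto
  have \<phi>_ex1: "\<exists>!h. h \<in> Hom C (L X) Y \<and> \<phi> X Y h = g"
    if "X \<in> Ob D" "Y \<in> Ob C" "g \<in> Hom D X (FOb G Y)" for X Y g
    unfolding \<phi>_def by (rule ex1[OF that])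
  have \<phi>_inj: "h = k"
    if "X \<in> Ob D" "Y \<in> Ob C" and h: "h \<in> Hom C (L X) Y" and k: "k \<in> Hom C (L X) Y"
      and "\<phi> X Y h = \<phi> X Y k" for X Y h k
    using \<phi>_ex1[OF that(1,2) \<phi>_in[OF that(1-3)]] h k that(5) by metis
  have \<phi>_surj: "\<exists>h\<in>Hom C (L X) Y. \<phi> X Y h = g"
    if "X \<in> Ob D" "Y \<in> Ob C" "g \<in> Hom D X (FOb G Y)" for X Y g
    using ex1_implies_ex[OF \<phi>_ex1[OF that]] by (elim exE conjE) (rule bexI)
  have nat: "\<phi> X Y' (Comp C (L X) Y Y' g h) = Comp D X (FOb G Y) (FOb G Y') (FHom G Y Y' g) (\<phi> X Y h)"
    if "X \<in> Ob D" "Y \<in> Ob C" "Y' \<in> Ob C" "h \<in> Hom C (L X) Y" "g \<in> Hom C Y Y'" for X Y Y' g h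
    unfolding \<phi>_def
    by (simp only: GC[OF L[OF that(1)] that(2-5)]
        D.Comp_assoc[OF that(1) GO[OF L[OF that(1)]] GO[OF that(2)] GO[OF that(3)]
          \<eta>[OF that(1)] GH[OF L[OF that(1)] that(2,4)] GH[OF that(2,3,5)]])
  have \<phi>_id: "\<phi> X (L X) (Idn C (L X)) = \<eta> X" if "X \<in> Ob D" for X
    using that unfolding \<phi>_def by (simp add: GI L GO \<eta> D.Comp_Idn_left)
  \<comment> \<open>The left adjoint has to make \<open>\<eta>\<close> natural, so
    \<open>LH X' X k\<close> is taken to be the map whose transpose is \<open>\<eta> X\<close> after
    \<open>k\<close>.\<close>
  define LH where "LH = (\<lambda>X' X k. SOME h. h \<in> Hom C (L X') (L X) \<and>
    \<phi> X' (L X) h = Comp D X' X (FOb G (L X)) (\<eta> X) k)"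
  have LH: "LH X' X k \<in> Hom C (L X') (L X)" "\<phi> X' (L X) (LH X' X k) = Comp D X' X (FOb G (L X)) (\<eta> X) k"
    if "X' \<in> Ob D" "X \<in> Ob D" "k \<in> Hom D X' X" for X' X k
  proof -
    have "\<exists>h. h \<in> Hom C (L X') (L X) \<and> \<phi> X' (L X) h = Comp D X' X (FOb G (L X)) (\<eta> X) k"
      using \<phi>_surj[OF that(1) L[OF that(2)] D.Comp_closed[OF that(1,2) GO[OF L[OF that(2)]] that(3) \<eta>[OF that(2)]]]
      by blast
    from someI_ex[OF this] show "LH X' X k \<in> Hom C (L X') (L X)"
      "\<phi> X' (L X) (LH X' X k) = Comp D X' X (FOb G (L X)) (\<eta> X) k"
      unfolding LH_def by blast+
  qed
  \<comment> \<open>Naturality in the first argument follows from naturality in the second, applied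
    to \<open>LH X' X k\<close>, whose transpose is known.\<close>
  have nat': "\<phi> X' Y (Comp C (L X') (L X) Y h (LH X' X k)) = Comp D X' X (FOb G Y) (\<phi> X Y h) k"
    if "X' \<in> Ob D" "X \<in> Ob D" "Y \<in> Ob C" "h \<in> Hom C (L X) Y" "k \<in> Hom D X' X" for X' X Y h k
  proof -
    have "\<phi> X' Y (Comp C (L X') (L X) Y h (LH X' X k)) =
        Comp D X' (FOb G (L X)) (FOb G Y) (FHom G (L X) Y h) (Comp D X' X (FOb G (L X)) (\<eta> X) k)"
      using nat[OF that(1) L[OF that(2)] that(3) LH(1)[OF that(1,2,5)] that(4)] LH(2)[OF that(1,2,5)]
      by simp
    also have "\<dots> = Comp D X' X (FOb G Y) (\<phi> X Y h) k"
      unfolding \<phi>_def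
      by (rule D.Comp_assoc[OF that(1,2) GO[OF L[OF that(2)]] GO[OF that(3)] that(5) \<eta>[OF that(2)]
            GH[OF L[OF that(2)] that(3,4)]])
    finally show ?thesis .
  qed
  define LF where "LF = \<lparr>FOb = L, FHom = LH\<rparr>"
  have "is_functor D C LF"
    unfolding is_functor_def LF_def functor_data.simps
  proof (intro conjI ballI C.category_axioms D.category_axioms L LH(1))
    show "LH X X (Idn D X) = Idn C (L X)" if "X \<in> Ob D" for X
      using that LH[OF that that D.Idn_closed[OF that]]
      by (intro \<phi>_inj[OF that L[OF that]]) (simp_all add: C.Idn_closed L \<phi>_id D.Comp_Idn_right GO \<eta>)
    show "LH X Z (Comp D X Y Z g h) = Comp C (L X) (L Y) (L Z) (LH Y Z g) (LH X Y h)"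
      if X: "X \<in> Ob D" and Y: "Y \<in> Ob D" and Z: "Z \<in> Ob D" and h: "h \<in> Hom D X Y" and g: "g \<in> Hom D Y Z"
      for X Y Z h g
    \<comment> \<open>Both sides have the same transpose, namely \<open>\<eta> Z\<close> after
      \<open>g\<close> after \<open>h\<close>.\<close>
    proof (rule \<phi>_inj[OF X L[OF Z]])
      have gh: "Comp D X Y Z g h \<in> Hom D X Z" using D.Comp_closed[OF X Y Z h g] .
      show "LH X Z (Comp D X Y Z g h) \<in> Hom C (L X) (L Z)" by (rule LH(1)[OF X Z gh])
      show "Comp C (L X) (L Y) (L Z) (LH Y Z g) (LH X Y h) \<in> Hom C (L X) (L Z)"
        by (rule C.Comp_closed[OF L[OF X] L[OF Y] L[OF Z] LH(1)[OF X Y h] LH(1)[OF Y Z g]])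
      show "\<phi> X (L Z) (LH X Z (Comp D X Y Z g h)) =
          \<phi> X (L Z) (Comp C (L X) (L Y) (L Z) (LH Y Z g) (LH X Y h))"
        unfolding LH(2)[OF X Z gh] nat'[OF X Y L[OF Z] LH(1)[OF Y Z g] h] LH(2)[OF Y Z g]
        by (rule D.Comp_assoc[OF X Y Z GO[OF L[OF Z]] h g \<eta>[OF Z]])
    qed
  qed
  moreover have "bij_betw (\<phi> X Y) (Hom C (L X) Y) (Hom D X (FOb G Y))" if "X \<in> Ob D" "Y \<in> Ob C" for X Y
    unfolding bij_betw_def
  proof
    show "inj_on (\<phi> X Y) (Hom C (L X) Y)" using \<phi>_inj[OF that] by (auto intro: inj_onI)
    show "\<phi> X Y ` Hom C (L X) Y = Hom D X (FOb G Y)"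
      using \<phi>_in[OF that] \<phi>_surj[OF that] by blast
  qed
  ultimately have "is_left_adjoint C D LF G"
    unfolding is_left_adjoint_def LF_def functor_data.simps
    using G nat nat' by (intro conjI exI[of _ \<phi>] ballI) simp_all
  then show ?thesis unfolding has_left_adjoint_def by blast
qed

subsection \<open>The stable category and the Heller operator\<close>

lemma (in abelian_group) minus_minus_minus:
  assumes "x \<in> carrier G" "y \<in> carrier G" "z \<in> carrier G"
  shows "(x \<ominus> y) \<ominus> (z \<ominus> y) = x \<ominus> z"
proof -
  have "(x \<ominus> y) \<ominus> (z \<ominus> y) = (x \<ominus> z) \<oplus> (y \<oplus> \<ominus> y)"
    using assms by (simp add: minus_eq minus_add a_ac)
  then show ?thesis using assms by (simp add: r_neg)
qed

text \<open>The stable category is built from one surjection from a projective for each object;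
  kernels enter with \<open>heller\<close>. The surjections will be those chosen for the Heller
  operator, so that stable equality and syzygies refer to the same projectives.\<close>

locale enough_projectives =
  fixes A :: "('a, 'r) ring_scheme"
    and P :: "('a, 'u::infinite) module \<Rightarrow> ('a, 'u) module"
    and q :: "('a, 'u) module \<Rightarrow> 'u \<Rightarrow> 'u"
  assumes ring_A: "ring A" and finite_A: "finite (carrier A)"
    and P_fg: "X \<in> fg_mods A \<Longrightarrow> P X \<in> fg_mods A"
    and P_projective: "X \<in> fg_mods A \<Longrightarrow> projective A (P X)"
    and q_lin: "X \<in> fg_mods A \<Longrightarrow> lin A (P X) X (q X)"
    and q_surj: "X \<in> fg_mods A \<Longrightarrow> q X ` carrier (P X) = carrier X"
begin

lemma right_module_fg: "X \<in> fg_mods A \<Longrightarrow> right_module A X"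
  by (simp add: fg_mods_def)

lemma right_module_P: "X \<in> fg_mods A \<Longrightarrow> right_module A (P X)"
  by (simp add: P_fg right_module_fg)

lemma abelian_group_fg: "X \<in> fg_mods A \<Longrightarrow> abelian_group X"
  using right_module_abelian_group right_module_fg by blast

text \<open>A map factors over some projective iff it lifts along the one cover \<open>q Y\<close>; no direct sums
  of projectives are then needed to see that such maps are closed under subtraction.\<close>

definition null :: "('a, 'u) module \<Rightarrow> ('a, 'u) module \<Rightarrow> ('u \<Rightarrow> 'u) \<Rightarrow> bool" where
  "null X Y h \<longleftrightarrow> (\<exists>t. lin A X (P Y) t \<and> (\<forall>x\<in>carrier X. h x = q Y (t x)))"

lemma nullI: "lin A X (P Y) t \<Longrightarrow> (\<And>x. x \<in> carrier X \<Longrightarrow> h x = q Y (t x)) \<Longrightarrow> null X Y h"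
  unfolding null_def by blast

lemma null_cong: "(\<And>x. x \<in> carrier X \<Longrightarrow> h x = k x) \<Longrightarrow> null X Y h \<longleftrightarrow> null X Y k"
  unfolding null_def by simp

text \<open>As \<open>Q\<close> is projective, \<open>v\<close> lifts along the surjection
  \<open>q Y\<close>; this lift after \<open>u\<close> is the required map to
  \<open>P Y\<close>.\<close>

lemma null_if_factors:
  fixes Q :: "('a, 'u) module"
  assumes "Y \<in> fg_mods A" "projective A Q" "lin A X Q u" "lin A Q Y v"
    and h: "\<And>x. x \<in> carrier X \<Longrightarrow> h x = v (u x)"
  shows "null X Y h"
proof -
  obtain k where k: "lin A Q (P Y) k" "\<And>x. x \<in> carrier Q \<Longrightarrow> q Y (k x) = v x"
    using projective_lift[OF assms(2) right_module_P[OF assms(1)] right_module_fg[OF assms(1)]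
        q_lin[OF assms(1)] q_surj[OF assms(1)] assms(4)]
    by blast
  show ?thesis
  proof (rule nullI[OF lin_compose[OF assms(3) k(1)]])
    show "h x = q Y (k (u x))" if "x \<in> carrier X" for x
      unfolding h[OF that] k(2)[OF linD(1)[OF assms(3) that]] ..
  qed
qed

text \<open>For the converse direction, \<open>P Y\<close> itself is the projective over which
  \<open>h\<close> factors.\<close>

lemma factors_proj_iff_null:
  assumes X: "X \<in> fg_mods A" and Y: "Y \<in> fg_mods A" and h: "h \<in> extensional (carrier X)"
  shows "factors_proj A X Y h \<longleftrightarrow> null X Y h"
proof
  assume "factors_proj A X Y h"
  then obtain Q u v where Q: "projective A Q" and uv: "u \<in> rhom A X Q" "v \<in> rhom A Q Y"
    and h_eq: "h = compose (carrier X) v u"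
    unfolding factors_proj_def by blast
  have "lin A X Q u" "lin A Q Y v" using uv by (simp_all add: rhom_iff)
  then show "null X Y h" by (rule null_if_factors[OF Y Q]) (simp add: h_eq compose_def)
next
  assume "null X Y h"
  then obtain t where t: "lin A X (P Y) t" and ht: "\<forall>x\<in>carrier X. h x = q Y (t x)"
    unfolding null_def by blast
  have "h = compose (carrier X) (restrict (q Y) (carrier (P Y))) (restrict t (carrier X))"
    using ht linD(1)[OF t] by (intro extensionalityI[OF h]) (auto simp: compose_def)
  then show "factors_proj A X Y h"
    unfolding factors_proj_def
    using P_fg[OF Y] P_projective[OF Y] rhom_restrict[OF right_module_fg[OF X] t]
      rhom_restrict[OF right_module_P[OF Y] q_lin[OF Y]] by blast
qed

lemma null_zero:
  assumes "X \<in> fg_mods A" "Y \<in> fg_mods A"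
  shows "null X Y (\<lambda>x. \<zero>\<^bsub>Y\<^esub>)"
  by (rule nullI[OF lin_zero[OF right_module_fg[OF assms(1)] right_module_P[OF assms(2)]]])
    (simp add: lin_zero_arg[OF right_module_P[OF assms(2)] right_module_fg[OF assms(2)] q_lin[OF assms(2)]])

lemma null_minus:
  assumes Y: "Y \<in> fg_mods A" and "null X Y h" "null X Y k"
  shows "null X Y (\<lambda>x. h x \<ominus>\<^bsub>Y\<^esub> k x)"
proof -
  obtain s t where st: "lin A X (P Y) s" "\<forall>x\<in>carrier X. h x = q Y (s x)"
    "lin A X (P Y) t" "\<forall>x\<in>carrier X. k x = q Y (t x)"
    using assms(2,3) unfolding null_def by blast
  show ?thesis
    using st linD(1)[OF st(1)] linD(1)[OF st(3)]
      lin_minus_arg[OF right_module_P[OF Y] right_module_fg[OF Y] q_lin[OF Y]]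
    by (intro nullI[OF lin_minus[OF right_module_P[OF Y] st(1,3)]]) simp
qed

text \<open>The composite factors over \<open>P Y\<close>, which covers the wrong object;
  \<open>null_if_factors\<close> turns this into a lift to \<open>P Z\<close>.\<close>

lemma null_compose_left:
  assumes "Y \<in> fg_mods A" "Z \<in> fg_mods A" "null X Y h" "lin A Y Z g"
  shows "null X Z (\<lambda>x. g (h x))"
proof -
  obtain t where t: "lin A X (P Y) t" "\<forall>x\<in>carrier X. h x = q Y (t x)"
    using assms(3) unfolding null_def by blast
  then show ?thesis
    by (intro null_if_factors[OF assms(2) P_projective[OF assms(1)] t(1) lin_compose[OF q_lin[OF assms(1)] assms(4)]])
      simp
qed

lemma null_compose_right:
  assumes "null Y Z g" "lin A X Y h"
  shows "null X Z (\<lambda>x. g (h x))"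
proof -
  obtain t where t: "lin A Y (P Z) t" "\<forall>y\<in>carrier Y. g y = q Z (t y)"
    using assms(1) unfolding null_def by blast
  then show ?thesis
    using linD(1)[OF assms(2)] by (intro nullI[OF lin_compose[OF assms(2) t(1)]]) simp
qed

lemma null_diff_refl:
  assumes "X \<in> fg_mods A" "Y \<in> fg_mods A" "lin A X Y h"
  shows "null X Y (\<lambda>x. h x \<ominus>\<^bsub>Y\<^esub> h x)"
proof -
  interpret Y: abelian_group Y by (rule abelian_group_fg[OF assms(2)])
  show ?thesis
    using null_zero[OF assms(1,2)] linD(1)[OF assms(3)]
    by (subst null_cong[where k = "\<lambda>x. \<zero>\<^bsub>Y\<^esub>"]) (simp_all add: Y.minus_eq_zero_iff)
qed

text \<open>This Euclidean property comes from closure under subtraction alone and, with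
  reflexivity, yields symmetry and transitivity of stable equality.\<close>

lemma null_diff_euclid:
  assumes "X \<in> fg_mods A" "Y \<in> fg_mods A" "lin A X Y h" "lin A X Y k" "lin A X Y l"
    and "null X Y (\<lambda>x. h x \<ominus>\<^bsub>Y\<^esub> k x)" "null X Y (\<lambda>x. l x \<ominus>\<^bsub>Y\<^esub> k x)"
  shows "null X Y (\<lambda>x. h x \<ominus>\<^bsub>Y\<^esub> l x)"
proof -
  interpret Y: abelian_group Y by (rule abelian_group_fg[OF assms(2)])
  have "null X Y (\<lambda>x. (h x \<ominus>\<^bsub>Y\<^esub> k x) \<ominus>\<^bsub>Y\<^esub> (l x \<ominus>\<^bsub>Y\<^esub> k x))"
    by (rule null_minus[OF assms(2,6,7)])
  then show ?thesis
    using linD(1)[OF assms(3)] linD(1)[OF assms(4)] linD(1)[OF assms(5)]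
    by (subst (asm) null_cong[where k = "\<lambda>x. h x \<ominus>\<^bsub>Y\<^esub> l x"]) (simp_all add: Y.minus_minus_minus)
qed

section \<open>Morphisms and composition in the stable category\<close>

lemma stable_rel_iff:
  assumes "X \<in> fg_mods A" "Y \<in> fg_mods A"
  shows "(h, k) \<in> stable_rel A X Y \<longleftrightarrow>
    h \<in> rhom A X Y \<and> k \<in> rhom A X Y \<and> null X Y (\<lambda>x. h x \<ominus>\<^bsub>Y\<^esub> k x)"
proof -
  have "null X Y (\<lambda>x\<in>carrier X. h x \<ominus>\<^bsub>Y\<^esub> k x) \<longleftrightarrow> null X Y (\<lambda>x. h x \<ominus>\<^bsub>Y\<^esub> k x)"
    by (rule null_cong) simp
  then show ?thesis
    unfolding stable_rel_def using factors_proj_iff_null[OF assms restrict_extensional] by simp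
qed

lemma equiv_stable_rel:
  fixes X Y :: "('a, 'u) module"
  assumes X: "X \<in> fg_mods A" and Y: "Y \<in> fg_mods A"
  shows "equiv (rhom A X Y) (stable_rel A X Y)"
proof -
  have refl: "(h, h) \<in> stable_rel A X Y" if "h \<in> rhom A X Y" for h
    using that null_diff_refl[OF X Y] by (simp add: stable_rel_iff[OF X Y] rhom_iff)
  have euclid: "(h, l) \<in> stable_rel A X Y" if "(h, k) \<in> stable_rel A X Y" "(l, k) \<in> stable_rel A X Y" for h k l
    using that null_diff_euclid[OF X Y, of h k l] by (simp add: stable_rel_iff[OF X Y] rhom_iff)
  have dom: "h \<in> rhom A X Y" "k \<in> rhom A X Y" if "(h, k) \<in> stable_rel A X Y" for h k
    using that by (simp_all add: stable_rel_iff[OF X Y])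
  have sym: "(k, h) \<in> stable_rel A X Y" if "(h, k) \<in> stable_rel A X Y" for h k
    using euclid[OF refl that] dom[OF that] by blast
  show ?thesis
  proof (rule equivI)
    show "stable_rel A X Y \<subseteq> rhom A X Y \<times> rhom A X Y" using dom by auto
    show "refl_on (rhom A X Y) (stable_rel A X Y)" using refl dom by (intro refl_onI) auto
    show "sym (stable_rel A X Y)" using sym by (rule symI)
    show "trans (stable_rel A X Y)" using euclid sym by (blast intro: transI)
  qed
qed

text \<open>Restricting first gives a class to maps that are not extensional, in parallel with the
  passage from \<open>rhom\<close> to \<open>lin\<close>.\<close>

definition cls :: "('a, 'u) module \<Rightarrow> ('a, 'u) module \<Rightarrow> ('u \<Rightarrow> 'u) \<Rightarrow> ('u \<Rightarrow> 'u) set" where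
  "cls X Y h = stable_class A X Y (restrict h (carrier X))"

lemma stable_class_eq_cls: "h \<in> rhom A X Y \<Longrightarrow> stable_class A X Y h = cls X Y h"
  by (simp add: cls_def rhom_iff extensional_restrict)

lemma cls_eq_iff:
  assumes X: "X \<in> fg_mods A" and Y: "Y \<in> fg_mods A" and h: "lin A X Y h" and k: "lin A X Y k"
  shows "cls X Y h = cls X Y k \<longleftrightarrow> null X Y (\<lambda>x. h x \<ominus>\<^bsub>Y\<^esub> k x)"
proof -
  have "null X Y (\<lambda>x. restrict h (carrier X) x \<ominus>\<^bsub>Y\<^esub> restrict k (carrier X) x) \<longleftrightarrow>
      null X Y (\<lambda>x. h x \<ominus>\<^bsub>Y\<^esub> k x)"
    by (rule null_cong) simp
  then show ?thesis
    unfolding cls_def stable_class_def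
    using eq_equiv_class_iff[OF equiv_stable_rel[OF X Y] rhom_restrict rhom_restrict,
        OF right_module_fg[OF X] h right_module_fg[OF X] k]
      rhom_restrict[OF right_module_fg[OF X] h] rhom_restrict[OF right_module_fg[OF X] k]
    by (simp add: stable_rel_iff[OF X Y])
qed

lemma Hom_stable_cat_iff:
  assumes "X \<in> fg_mods A"
  shows "f \<in> Hom (stable_cat A) X Y \<longleftrightarrow> (\<exists>h. lin A X Y h \<and> f = cls X Y h)"
proof
  assume "f \<in> Hom (stable_cat A) X Y"
  then obtain h where "h \<in> rhom A X Y" "f = stable_class A X Y h"
    unfolding stable_cat_def stable_class_def by (auto elim: quotientE)
  then show "\<exists>h. lin A X Y h \<and> f = cls X Y h" using stable_class_eq_cls by (auto simp: rhom_iff)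
next
  assume "\<exists>h. lin A X Y h \<and> f = cls X Y h"
  then show "f \<in> Hom (stable_cat A) X Y"
    unfolding stable_cat_def cls_def stable_class_def
    using rhom_restrict[OF right_module_fg[OF assms]] by (auto intro: quotientI)
qed

lemma cls_in_Hom: "X \<in> fg_mods A \<Longrightarrow> lin A X Y h \<Longrightarrow> cls X Y h \<in> Hom (stable_cat A) X Y"
  using Hom_stable_cat_iff by blast

lemma Idn_stable_cat: "Idn (stable_cat A) X = cls X X (\<lambda>x. x)"
  by (simp add: stable_cat_def cls_def)

lemma Ob_stable_cat: "Ob (stable_cat A) = fg_mods A"
  by (simp add: stable_cat_def)

text \<open>One factor is changed at a time: \<open>g\<close> after the null difference of
  \<open>h\<close> and \<open>h'\<close> is null, and so is the null difference of \<open>g\<close>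
  and \<open>g'\<close> after \<open>h'\<close>.\<close>

lemma cls_compose_cong:
  assumes X: "X \<in> fg_mods A" and Y: "Y \<in> fg_mods A" and Z: "Z \<in> fg_mods A"
    and h: "lin A X Y h" "lin A X Y h'" and g: "lin A Y Z g" "lin A Y Z g'"
    and "cls X Y h = cls X Y h'" "cls Y Z g = cls Y Z g'"
  shows "cls X Z (\<lambda>x. g (h x)) = cls X Z (\<lambda>x. g' (h' x))"
proof -
  have "null X Z (\<lambda>x. g (h x \<ominus>\<^bsub>Y\<^esub> h' x))"
    using assms(8) cls_eq_iff[OF X Y h] by (intro null_compose_left[OF Y Z _ g(1)]) simp
  then have "null X Z (\<lambda>x. g (h x) \<ominus>\<^bsub>Z\<^esub> g (h' x))"
    using linD(1)[OF h(1)] linD(1)[OF h(2)]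
      lin_minus_arg[OF right_module_fg[OF Y] right_module_fg[OF Z] g(1)]
    by (subst null_cong[where k = "\<lambda>x. g (h x \<ominus>\<^bsub>Y\<^esub> h' x)"]) simp_all
  then have "cls X Z (\<lambda>x. g (h x)) = cls X Z (\<lambda>x. g (h' x))"
    using cls_eq_iff[OF X Z lin_compose[OF h(1) g(1)] lin_compose[OF h(2) g(1)]] by simp
  moreover have "null X Z (\<lambda>x. g (h' x) \<ominus>\<^bsub>Z\<^esub> g' (h' x))"
    using null_compose_right[OF _ h(2)] assms(9) cls_eq_iff[OF Y Z g] by blast
  then have "cls X Z (\<lambda>x. g (h' x)) = cls X Z (\<lambda>x. g' (h' x))"
    using cls_eq_iff[OF X Z lin_compose[OF h(2) g(1)] lin_compose[OF h(2) g(2)]] by simp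
  ultimately show ?thesis by simp
qed

lemma mem_clsD:
  assumes X: "X \<in> fg_mods A" and Y: "Y \<in> fg_mods A" and h: "lin A X Y h" and h': "h' \<in> cls X Y h"
  shows "lin A X Y h'" "cls X Y h' = cls X Y h"
proof -
  have rel: "(restrict h (carrier X), h') \<in> stable_rel A X Y"
    using h' by (simp add: cls_def stable_class_def)
  then have r: "h' \<in> rhom A X Y" by (simp add: stable_rel_iff[OF X Y])
  then show "lin A X Y h'" by (simp add: rhom_iff)
  show "cls X Y h' = cls X Y h"
    using equiv_class_eq[OF equiv_stable_rel[OF X Y] rel] stable_class_eq_cls[OF r]
    by (simp add: cls_def stable_class_def)
qed

text \<open>\<open>Comp\<close> is a union over all pairs of representatives. By
  \<open>cls_compose_cong\<close> every pair contributes the same class, and both classes are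
  nonempty, so the union is that class.\<close>

lemma Comp_cls:
  assumes X: "X \<in> fg_mods A" and Y: "Y \<in> fg_mods A" and Z: "Z \<in> fg_mods A"
    and h: "lin A X Y h" and g: "lin A Y Z g"
  shows "Comp (stable_cat A) X Y Z (cls Y Z g) (cls X Y h) = cls X Z (\<lambda>x. g (h x))"
proof -
  have eq: "stable_class A X Z (compose (carrier X) g' h') = cls X Z (\<lambda>x. g (h x))"
    if "g' \<in> cls Y Z g" "h' \<in> cls X Y h" for g' h'
  proof -
    have "stable_class A X Z (compose (carrier X) g' h') = cls X Z (\<lambda>x. g' (h' x))"
      by (simp add: cls_def compose_def)
    then show ?thesis
      using mem_clsD[OF X Y h that(2)] mem_clsD[OF Y Z g that(1)] cls_compose_cong[OF X Y Z _ h _ g]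
      by simp
  qed
  have "restrict h (carrier X) \<in> cls X Y h" "restrict g (carrier Y) \<in> cls Y Z g"
    unfolding cls_def stable_class_def
    using equiv_class_self[OF equiv_stable_rel] rhom_restrict right_module_fg X Y Z h g by blast+
  then show ?thesis unfolding stable_cat_def using eq by auto
qed

text \<open>Once composition is computed on representatives, the unit and associativity laws are
  identities between functions.\<close>

lemma category_stable_cat: "category (stable_cat A :: (('a, 'u) module, ('u \<Rightarrow> 'u) set) cat)"
proof (unfold_locales, unfold Ob_stable_cat)
  show "Idn (stable_cat A) X \<in> Hom (stable_cat A) X X" if "X \<in> fg_mods A" for X :: "('a, 'u) module"
    using that by (simp add: Idn_stable_cat cls_in_Hom lin_id)
  fix W X Y Z :: "('a, 'u) module" and f g k
  assume W: "W \<in> fg_mods A" and X: "X \<in> fg_mods A" 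
  {
    assume Y: "Y \<in> fg_mods A"
    {
      assume "f \<in> Hom (stable_cat A) W X" "g \<in> Hom (stable_cat A) X Y"
      then show "Comp (stable_cat A) W X Y g f \<in> Hom (stable_cat A) W Y"
        unfolding Hom_stable_cat_iff[OF W] Hom_stable_cat_iff[OF X]
        using Comp_cls[OF W X Y] lin_compose by blast
    }
    assume Z: "Z \<in> fg_mods A"
      and "f \<in> Hom (stable_cat A) W X" "g \<in> Hom (stable_cat A) X Y" "k \<in> Hom (stable_cat A) Y Z"
    then obtain f' g' k' where *: "lin A W X f'" "f = cls W X f'" "lin A X Y g'" "g = cls X Y g'"
      "lin A Y Z k'" "k = cls Y Z k'"
      unfolding Hom_stable_cat_iff[OF W] Hom_stable_cat_iff[OF X] Hom_stable_cat_iff[OF Y] by blast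
    show "Comp (stable_cat A) W Y Z k (Comp (stable_cat A) W X Y g f) =
        Comp (stable_cat A) W X Z (Comp (stable_cat A) X Y Z k g) f"
      unfolding *(2,4,6) Comp_cls[OF W X Y *(1,3)] Comp_cls[OF X Y Z *(3,5)]
        Comp_cls[OF W Y Z lin_compose[OF *(1,3)] *(5)] Comp_cls[OF W X Z *(1) lin_compose[OF *(3,5)]] ..
  }
  {
    assume "f \<in> Hom (stable_cat A) W X"
    then obtain f' where *: "lin A W X f'" "f = cls W X f'" unfolding Hom_stable_cat_iff[OF W] by blast
    show "Comp (stable_cat A) W X X (Idn (stable_cat A) X) f = f"
      unfolding *(2) Idn_stable_cat Comp_cls[OF W X X *(1) lin_id] ..
    show "Comp (stable_cat A) W W X f (Idn (stable_cat A) W) = f"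
      unfolding *(2) Idn_stable_cat Comp_cls[OF W W X lin_id *(1)] ..
  }
qed

end

section \<open>Functoriality of the Heller operator\<close>

text \<open>These are the choices of \<open>heller_operator\<close>, read pointwise.
  \<open>\<Omega>_lift\<close> says that some lift of \<open>h\<close> represents the image of its
  class; that every lift does is proved in \<open>FHom_cls\<close>.\<close>

locale heller = enough_projectives A P q
  for A :: "('a, 'r) ring_scheme"
    and P :: "('a, 'u::infinite) module \<Rightarrow> ('a, 'u) module"
    and q :: "('a, 'u) module \<Rightarrow> 'u \<Rightarrow> 'u" +
  fixes \<Omega> :: "(('a, 'u) module, ('u \<Rightarrow> 'u) set, ('a, 'u) module, ('u \<Rightarrow> 'u) set) functor_data"
    and i :: "('a, 'u) module \<Rightarrow> 'u \<Rightarrow> 'u"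
  assumes \<Omega>_fg: "X \<in> fg_mods A \<Longrightarrow> FOb \<Omega> X \<in> fg_mods A"
    and i_lin: "X \<in> fg_mods A \<Longrightarrow> lin A (FOb \<Omega> X) (P X) (i X)"
    and i_inj: "X \<in> fg_mods A \<Longrightarrow> inj_on (i X) (carrier (FOb \<Omega> X))"
    and i_image: "X \<in> fg_mods A \<Longrightarrow>
      i X ` carrier (FOb \<Omega> X) = {y \<in> carrier (P X). q X y = \<zero>\<^bsub>X\<^esub>}"
    and \<Omega>_lift: "\<lbrakk>X \<in> fg_mods A; Y \<in> fg_mods A; lin A X Y h\<rbrakk> \<Longrightarrow>
      \<exists>h' k. lin A (FOb \<Omega> X) (FOb \<Omega> Y) h' \<and> lin A (P X) (P Y) k \<and>
        (\<forall>y\<in>carrier (P X). q Y (k y) = h (q X y)) \<and>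
        (\<forall>z\<in>carrier (FOb \<Omega> X). i Y (h' z) = k (i X z)) \<and>
        FHom \<Omega> X Y (cls X Y h) = cls (FOb \<Omega> X) (FOb \<Omega> Y) h'"
begin

text \<open>\<open>(h', k, h)\<close> is a morphism between the chosen short exact sequences.\<close>

definition lift_of :: "('a, 'u) module \<Rightarrow> ('a, 'u) module \<Rightarrow> ('u \<Rightarrow> 'u) \<Rightarrow> ('u \<Rightarrow> 'u) \<Rightarrow> ('u \<Rightarrow> 'u) \<Rightarrow> bool" where
  "lift_of X Y h h' k \<longleftrightarrow> lin A X Y h \<and> lin A (FOb \<Omega> X) (FOb \<Omega> Y) h' \<and> lin A (P X) (P Y) k \<and>
    (\<forall>y\<in>carrier (P X). q Y (k y) = h (q X y)) \<and>
    (\<forall>z\<in>carrier (FOb \<Omega> X). i Y (h' z) = k (i X z))"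

lemma q_i: "X \<in> fg_mods A \<Longrightarrow> z \<in> carrier (FOb \<Omega> X) \<Longrightarrow> q X (i X z) = \<zero>\<^bsub>X\<^esub>"
  using i_image by blast

text \<open>The universal property of the syzygy as a kernel; it produces the unit and the
  correction maps \<open>s\<close> below.\<close>

lemma factor_through_\<Omega>:
  assumes Z: "right_module A Z" and X: "X \<in> fg_mods A" and f: "lin A Z (P X) f"
    and qf: "\<And>z. z \<in> carrier Z \<Longrightarrow> q X (f z) = \<zero>\<^bsub>X\<^esub>"
  obtains s where "lin A Z (FOb \<Omega> X) s" "\<And>z. z \<in> carrier Z \<Longrightarrow> i X (s z) = f z"
proof -
  have "f z \<in> i X ` carrier (FOb \<Omega> X)" if "z \<in> carrier Z" for z
    unfolding i_image[OF X] using qf[OF that] linD(1)[OF f that] by simp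
  then show ?thesis
    using lift_to_kernel[OF right_module_fg[OF \<Omega>_fg[OF X]] right_module_P[OF X] Z i_lin[OF X] i_inj[OF X] f]
      that by blast
qed

text \<open>Subtracting lifts reduces a comparison of two lifts, or of two morphisms, to a statement
  about null maps.\<close>

lemma lift_of_minus:
  assumes X: "X \<in> fg_mods A" and Y: "Y \<in> fg_mods A"
    and 1: "lift_of X Y h1 h1' k1" and 2: "lift_of X Y h2 h2' k2"
  shows "lift_of X Y (\<lambda>x. h1 x \<ominus>\<^bsub>Y\<^esub> h2 x) (\<lambda>x. h1' x \<ominus>\<^bsub>FOb \<Omega> Y\<^esub> h2' x) (\<lambda>x. k1 x \<ominus>\<^bsub>P Y\<^esub> k2 x)"
  unfolding lift_of_def
proof (intro conjI ballI)
  note r = right_module_fg[OF X] right_module_fg[OF Y] right_module_fg[OF \<Omega>_fg[OF X]]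
    right_module_fg[OF \<Omega>_fg[OF Y]] right_module_P[OF X] right_module_P[OF Y]
  note l = 1[unfolded lift_of_def] 2[unfolded lift_of_def]
  show "lin A X Y (\<lambda>x. h1 x \<ominus>\<^bsub>Y\<^esub> h2 x)"
    "lin A (FOb \<Omega> X) (FOb \<Omega> Y) (\<lambda>x. h1' x \<ominus>\<^bsub>FOb \<Omega> Y\<^esub> h2' x)"
    "lin A (P X) (P Y) (\<lambda>x. k1 x \<ominus>\<^bsub>P Y\<^esub> k2 x)"
    using l by (auto intro: lin_minus r)
  have k: "lin A (P X) (P Y) k1" "lin A (P X) (P Y) k2" using l by auto
  have h': "lin A (FOb \<Omega> X) (FOb \<Omega> Y) h1'" "lin A (FOb \<Omega> X) (FOb \<Omega> Y) h2'" using l by auto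
  show "q Y (k1 y \<ominus>\<^bsub>P Y\<^esub> k2 y) = h1 (q X y) \<ominus>\<^bsub>Y\<^esub> h2 (q X y)" if "y \<in> carrier (P X)" for y
    using that l lin_minus_arg[OF r(6,2) q_lin[OF Y]] linD(1)[OF k(1) that] linD(1)[OF k(2) that] by simp
  show "i Y (h1' z \<ominus>\<^bsub>FOb \<Omega> Y\<^esub> h2' z) = k1 (i X z) \<ominus>\<^bsub>P Y\<^esub> k2 (i X z)" if "z \<in> carrier (FOb \<Omega> X)" for z
    using that l lin_minus_arg[OF r(4,6) i_lin[OF Y]] linD(1)[OF h'(1) that] linD(1)[OF h'(2) that] by simp
qed

text \<open>A homotopy argument. With \<open>t\<close> lifting \<open>h\<close> along
  \<open>q Y\<close>, the map \<open>k\<close> minus \<open>t\<close> after \<open>q X\<close> lands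
  in the kernel of \<open>q Y\<close> and so gives \<open>s\<close> from \<open>P X\<close> to the
  syzygy of \<open>Y\<close>. As \<open>q X\<close> kills the image of \<open>i X\<close>, the map
  \<open>s\<close> after \<open>i X\<close> equals \<open>h'\<close>, which thus factors over
  \<open>P X\<close>.\<close>

lemma null_lift:
  assumes X: "X \<in> fg_mods A" and Y: "Y \<in> fg_mods A" and l: "lift_of X Y h h' k" and n: "null X Y h"
  shows "null (FOb \<Omega> X) (FOb \<Omega> Y) h'"
proof -
  obtain t where t: "lin A X (P Y) t" and ht: "\<forall>x\<in>carrier X. h x = q Y (t x)"
    using n unfolding null_def by blast
  have h': "lin A (FOb \<Omega> X) (FOb \<Omega> Y) h'" and k: "lin A (P X) (P Y) k"
    and qk: "\<And>y. y \<in> carrier (P X) \<Longrightarrow> q Y (k y) = h (q X y)"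
    and ih: "\<And>z. z \<in> carrier (FOb \<Omega> X) \<Longrightarrow> i Y (h' z) = k (i X z)"
    using l by (auto simp: lift_of_def)
  interpret Y: abelian_group Y by (rule abelian_group_fg[OF Y])
  interpret PY: abelian_group "P Y" by (rule abelian_group_fg[OF P_fg[OF Y]])
  have tq: "lin A (P X) (P Y) (\<lambda>y. t (q X y))" by (rule lin_compose[OF q_lin[OF X] t])
  have "q Y (k y \<ominus>\<^bsub>P Y\<^esub> t (q X y)) = \<zero>\<^bsub>Y\<^esub>" if y: "y \<in> carrier (P X)" for y
    using linD(1)[OF k y] linD(1)[OF tq y] linD(1)[OF q_lin[OF X] y] linD(1)[OF q_lin[OF Y]] ht qk[OF y]
      lin_minus_arg[OF right_module_P[OF Y] right_module_fg[OF Y] q_lin[OF Y]]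
    by (simp add: Y.minus_eq_zero_iff)
  then obtain s where s: "lin A (P X) (FOb \<Omega> Y) s"
    and is_eq: "\<And>y. y \<in> carrier (P X) \<Longrightarrow> i Y (s y) = k y \<ominus>\<^bsub>P Y\<^esub> t (q X y)"
    using factor_through_\<Omega>[OF right_module_P[OF X] Y lin_minus[OF right_module_P[OF Y] k tq]] by blast
  show ?thesis
  proof (rule null_if_factors[OF \<Omega>_fg[OF Y] P_projective[OF X] i_lin[OF X] s])
    fix z assume z: "z \<in> carrier (FOb \<Omega> X)"
    have iz: "i X z \<in> carrier (P X)" by (rule linD(1)[OF i_lin[OF X] z])
    have "i Y (s (i X z)) = i Y (h' z)"
      unfolding is_eq[OF iz] q_i[OF X z] ih[OF z] lin_zero_arg[OF right_module_fg[OF X] right_module_P[OF Y] t]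
      by (rule PY.minus_zero_right[OF linD(1)[OF k iz]])
    then show "h' z = s (i X z)"
      using inj_onD[OF i_inj[OF Y]] linD(1)[OF s iz] linD(1)[OF h' z] by metis
  qed
qed

lemma ex_lift_of:
  assumes "X \<in> fg_mods A" "Y \<in> fg_mods A" "lin A X Y h"
  obtains h' k where "lift_of X Y h h' k" "FHom \<Omega> X Y (cls X Y h) = cls (FOb \<Omega> X) (FOb \<Omega> Y) h'"
  using \<Omega>_lift[OF assms] assms(3) unfolding lift_of_def by blast

text \<open>Two lifts of the same \<open>h\<close> differ by a lift of \<open>h\<close> minus
  \<open>h\<close>, which is null; by \<open>null_lift\<close> their syzygy parts agree
  stably.\<close>

lemma FHom_cls:
  assumes X: "X \<in> fg_mods A" and Y: "Y \<in> fg_mods A" and l: "lift_of X Y h h' k"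
  shows "FHom \<Omega> X Y (cls X Y h) = cls (FOb \<Omega> X) (FOb \<Omega> Y) h'"
proof -
  have h: "lin A X Y h" "lin A (FOb \<Omega> X) (FOb \<Omega> Y) h'" using l by (auto simp: lift_of_def)
  obtain h2 k2 where l2: "lift_of X Y h h2 k2" and eq: "FHom \<Omega> X Y (cls X Y h) = cls (FOb \<Omega> X) (FOb \<Omega> Y) h2"
    using ex_lift_of[OF X Y h(1)] by blast
  have h2: "lin A (FOb \<Omega> X) (FOb \<Omega> Y) h2" using l2 by (auto simp: lift_of_def)
  show ?thesis
    unfolding eq cls_eq_iff[OF \<Omega>_fg[OF X] \<Omega>_fg[OF Y] h2 h(2)]
    by (rule null_lift[OF X Y lift_of_minus[OF X Y l2 l] null_diff_refl[OF X Y h(1)]])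
qed

text \<open>Identities lift identities and composites of lifts lift composites, so
  \<open>FHom_cls\<close> gives the functor laws.\<close>

lemma is_functor_\<Omega>: "is_functor (stable_cat A) (stable_cat A) \<Omega>"
  unfolding is_functor_def Ob_stable_cat
proof (intro conjI ballI category_stable_cat \<Omega>_fg)
  show "FHom \<Omega> X Y f \<in> Hom (stable_cat A) (FOb \<Omega> X) (FOb \<Omega> Y)"
    if X: "X \<in> fg_mods A" and Y: "Y \<in> fg_mods A" and f: "f \<in> Hom (stable_cat A) X Y" for X Y f
  proof -
    obtain h where h: "lin A X Y h" "f = cls X Y h" using f Hom_stable_cat_iff[OF X] by blast
    obtain h' k where "lift_of X Y h h' k" "FHom \<Omega> X Y f = cls (FOb \<Omega> X) (FOb \<Omega> Y) h'"
      using ex_lift_of[OF X Y h(1)] h(2) by blast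
    then show ?thesis using cls_in_Hom[OF \<Omega>_fg[OF X]] by (simp add: lift_of_def)
  qed
  show "FHom \<Omega> X X (Idn (stable_cat A) X) = Idn (stable_cat A) (FOb \<Omega> X)" if X: "X \<in> fg_mods A" for X
    unfolding Idn_stable_cat
    by (rule FHom_cls[OF X X, where k = "\<lambda>y. y"]) (simp add: lift_of_def lin_id)
  show "FHom \<Omega> X Z (Comp (stable_cat A) X Y Z g f) =
      Comp (stable_cat A) (FOb \<Omega> X) (FOb \<Omega> Y) (FOb \<Omega> Z) (FHom \<Omega> Y Z g) (FHom \<Omega> X Y f)"
    if X: "X \<in> fg_mods A" and Y: "Y \<in> fg_mods A" and Z: "Z \<in> fg_mods A"
      and f: "f \<in> Hom (stable_cat A) X Y" and g: "g \<in> Hom (stable_cat A) Y Z" for X Y Z f g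
  proof -
    obtain f1 where f1: "lin A X Y f1" "f = cls X Y f1" using f Hom_stable_cat_iff[OF X] by blast
    obtain g1 where g1: "lin A Y Z g1" "g = cls Y Z g1" using g Hom_stable_cat_iff[OF Y] by blast
    obtain f' k where lf: "lift_of X Y f1 f' k" using ex_lift_of[OF X Y f1(1)] by blast
    obtain g' l where lg: "lift_of Y Z g1 g' l" using ex_lift_of[OF Y Z g1(1)] by blast
    have l': "lin A (FOb \<Omega> X) (FOb \<Omega> Y) f'" "lin A (FOb \<Omega> Y) (FOb \<Omega> Z) g'" "lin A (P X) (P Y) k"
      using lf lg by (auto simp: lift_of_def)
    have "lift_of X Z (\<lambda>x. g1 (f1 x)) (\<lambda>x. g' (f' x)) (\<lambda>y. l (k y))"
      using lf lg linD(1)[OF l'(1)] linD(1)[OF l'(3)] unfolding lift_of_def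
      by (auto intro: lin_compose)
    from FHom_cls[OF X Z this] show ?thesis
      unfolding f1(2) g1(2) Comp_cls[OF X Y Z f1(1) g1(1)] FHom_cls[OF X Y lf] FHom_cls[OF Y Z lg]
        Comp_cls[OF \<Omega>_fg[OF X] \<Omega>_fg[OF Y] \<Omega>_fg[OF Z] l'(1,2)] .
  qed
qed

section \<open>The universal arrow and the adjunction\<close>

text \<open>Representatives and nullity replace classes here. Uniqueness takes the form that a map
  with null transpose is null; this is enough because lifts can be subtracted.\<close>

lemma universal_arrow:
  assumes X: "X \<in> fg_mods A"
  shows "\<exists>C\<in>fg_mods A. \<exists>\<eta>. lin A X (FOb \<Omega> C) \<eta> \<and> (\<forall>Y\<in>fg_mods A.
    (\<forall>g. lin A X (FOb \<Omega> Y) g \<longrightarrow>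
      (\<exists>h h' k. lift_of C Y h h' k \<and> null X (FOb \<Omega> Y) (\<lambda>x. h' (\<eta> x) \<ominus>\<^bsub>FOb \<Omega> Y\<^esub> g x))) \<and>
    (\<forall>h h' k. lift_of C Y h h' k \<longrightarrow> null X (FOb \<Omega> Y) (\<lambda>x. h' (\<eta> x)) \<longrightarrow> null C Y h))"
proof -
  have X': "right_module A X" by (rule right_module_fg[OF X])
  obtain Q :: "('a, 'u) module" and u where Q: "Q \<in> fg_mods A" "projective A Q" and u: "lin A X Q u"
    and approx: "\<And>(R :: ('a, 'u) module) g. \<lbrakk>R \<in> fg_mods A; projective A R; lin A X R g\<rbrakk>
      \<Longrightarrow> \<exists>e. lin A Q R e \<and> (\<forall>x\<in>carrier X. e (u x) = g x)"
    using left_projective_approximation[OF ring_A finite_A X] by metis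
  have Q': "right_module A Q" by (rule right_module_fg[OF Q(1)])
  obtain C :: "('a, 'u) module" and c where C: "C \<in> fg_mods A" and c: "lin A Q C c" "c ` carrier Q = carrier C"
    and ker: "\<And>y. y \<in> carrier Q \<Longrightarrow> c y = \<zero>\<^bsub>C\<^esub> \<longleftrightarrow> y \<in> u ` carrier X"
    using cokernel[OF finite_A X' Q(1) u] by blast
  have cu: "c (u x) = \<zero>\<^bsub>C\<^esub>" if "x \<in> carrier X" for x
    using that ker linD(1)[OF u that] by blast
  obtain \<kappa> where \<kappa>: "lin A Q (P C) \<kappa>" and q\<kappa>: "\<And>y. y \<in> carrier Q \<Longrightarrow> q C (\<kappa> y) = c y"
    using projective_lift[OF Q(2) right_module_P[OF C] right_module_fg[OF C] q_lin[OF C] q_surj[OF C] c(1)]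
    by blast
  \<comment> \<open>\<open>q C\<close> sends \<open>\<kappa> (u x)\<close> to
    \<open>c (u x)\<close>, which is zero.\<close>
  obtain \<eta> where \<eta>: "lin A X (FOb \<Omega> C) \<eta>" and i\<eta>: "\<And>x. x \<in> carrier X \<Longrightarrow> i C (\<eta> x) = \<kappa> (u x)"
    using factor_through_\<Omega>[OF X' C lin_compose[OF u \<kappa>]] q\<kappa> cu linD(1)[OF u] by metis
  show ?thesis
  proof (rule bexI[OF _ C], rule exI[of _ \<eta>], intro conjI ballI allI impI \<eta>)
    fix Y g assume Y: "Y \<in> fg_mods A" and g: "lin A X (FOb \<Omega> Y) g"
    interpret Y: abelian_group Y by (rule abelian_group_fg[OF Y])
    note Y' = right_module_fg[OF Y] right_module_P[OF Y]
    obtain e where e: "lin A Q (P Y) e" and eu: "\<And>x. x \<in> carrier X \<Longrightarrow> e (u x) = i Y (g x)"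
      using approx[OF P_fg[OF Y] P_projective[OF Y] lin_compose[OF g i_lin[OF Y]]] by blast
    \<comment> \<open>The kernel of \<open>c\<close> is the image of \<open>u\<close>, where
      \<open>e\<close> agrees with \<open>i Y\<close> after \<open>g\<close> and is killed by
      \<open>q Y\<close>.\<close>
    have "q Y (e y) = \<zero>\<^bsub>Y\<^esub>" if y: "y \<in> carrier Q" "c y = \<zero>\<^bsub>C\<^esub>" for y
      using ker[OF y(1)] y(2) eu q_i[OF Y] linD(1)[OF g] by auto
    then obtain h where h: "lin A C Y h" and hc: "\<And>y. y \<in> carrier Q \<Longrightarrow> h (c y) = q Y (e y)"
      using factor_through_surj[OF Q' right_module_fg[OF C] Y'(1) c lin_compose[OF e q_lin[OF Y]]] by blast
    obtain h' k where l: "lift_of C Y h h' k" using ex_lift_of[OF C Y h] by blast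
    then have h': "lin A (FOb \<Omega> C) (FOb \<Omega> Y) h'" and k: "lin A (P C) (P Y) k"
      and qk: "\<And>y. y \<in> carrier (P C) \<Longrightarrow> q Y (k y) = h (q C y)"
      and ih: "\<And>z. z \<in> carrier (FOb \<Omega> C) \<Longrightarrow> i Y (h' z) = k (i C z)"
      by (auto simp: lift_of_def)
    have k\<kappa>: "lin A Q (P Y) (\<lambda>y. k (\<kappa> y))" by (rule lin_compose[OF \<kappa> k])
    \<comment> \<open>Both \<open>k\<close> after \<open>\<kappa>\<close> and \<open>e\<close> lift
      \<open>h\<close> after \<open>c\<close> along \<open>q Y\<close>, so their difference comes
      from a map \<open>s\<close> into the syzygy. On \<open>u x\<close> this \<open>s\<close> is
      the discrepancy between \<open>h' (\<eta> x)\<close> and \<open>g x\<close>, which therefore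
      factors over \<open>Q\<close>.\<close>
    have "q Y (k (\<kappa> y) \<ominus>\<^bsub>P Y\<^esub> e y) = \<zero>\<^bsub>Y\<^esub>" if y: "y \<in> carrier Q" for y
      unfolding lin_minus_arg[OF Y'(2,1) q_lin[OF Y] linD(1)[OF k\<kappa> y] linD(1)[OF e y]]
        qk[OF linD(1)[OF \<kappa> y]] q\<kappa>[OF y] hc[OF y]
      using linD(1)[OF q_lin[OF Y] linD(1)[OF e y]] by (simp add: Y.minus_eq_zero_iff)
    then obtain s where s: "lin A Q (FOb \<Omega> Y) s"
      and is_eq: "\<And>y. y \<in> carrier Q \<Longrightarrow> i Y (s y) = k (\<kappa> y) \<ominus>\<^bsub>P Y\<^esub> e y"
      using factor_through_\<Omega>[OF Q' Y lin_minus[OF Y'(2) k\<kappa> e]] by blast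
    have "null X (FOb \<Omega> Y) (\<lambda>x. h' (\<eta> x) \<ominus>\<^bsub>FOb \<Omega> Y\<^esub> g x)"
    proof (rule null_if_factors[OF \<Omega>_fg[OF Y] Q(2) u s])
      fix x assume x: "x \<in> carrier X"
      interpret \<Omega>Y: abelian_group "FOb \<Omega> Y" by (rule abelian_group_fg[OF \<Omega>_fg[OF Y]])
      have c: "h' (\<eta> x) \<in> carrier (FOb \<Omega> Y)" "g x \<in> carrier (FOb \<Omega> Y)"
        using linD(1)[OF h' linD(1)[OF \<eta> x]] linD(1)[OF g x] .
      have "i Y (h' (\<eta> x) \<ominus>\<^bsub>FOb \<Omega> Y\<^esub> g x) = i Y (s (u x))"
        unfolding lin_minus_arg[OF right_module_fg[OF \<Omega>_fg[OF Y]] Y'(2) i_lin[OF Y] c]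
          is_eq[OF linD(1)[OF u x]] ih[OF linD(1)[OF \<eta> x]] i\<eta>[OF x] eu[OF x] ..
      then show "h' (\<eta> x) \<ominus>\<^bsub>FOb \<Omega> Y\<^esub> g x = s (u x)"
        using \<Omega>Y.minus_closed[OF c] linD(1)[OF s linD(1)[OF u x]] by (rule inj_onD[OF i_inj[OF Y]])
    qed
    with l show "\<exists>h h' k. lift_of C Y h h' k \<and> null X (FOb \<Omega> Y) (\<lambda>x. h' (\<eta> x) \<ominus>\<^bsub>FOb \<Omega> Y\<^esub> g x)" by blast
  next
    fix Y h h' k assume Y: "Y \<in> fg_mods A" and l: "lift_of C Y h h' k"
      and n: "null X (FOb \<Omega> Y) (\<lambda>x. h' (\<eta> x))"
    note Y' = right_module_fg[OF Y] right_module_P[OF Y]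
    note \<Omega>Y = \<Omega>_fg[OF Y]
    interpret Y: abelian_group Y by (rule abelian_group_fg[OF Y])
    interpret PY: abelian_group "P Y" by (rule abelian_group_fg[OF P_fg[OF Y]])
    have h: "lin A C Y h" and h': "lin A (FOb \<Omega> C) (FOb \<Omega> Y) h'" and k: "lin A (P C) (P Y) k"
      and qk: "\<And>y. y \<in> carrier (P C) \<Longrightarrow> q Y (k y) = h (q C y)"
      and ih: "\<And>z. z \<in> carrier (FOb \<Omega> C) \<Longrightarrow> i Y (h' z) = k (i C z)"
      using l by (auto simp: lift_of_def)
    obtain w where w: "lin A X (P (FOb \<Omega> Y)) w"
      and hw: "\<And>x. x \<in> carrier X \<Longrightarrow> h' (\<eta> x) = q (FOb \<Omega> Y) (w x)"
      using n unfolding null_def by blast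
    obtain e where e: "lin A Q (P (FOb \<Omega> Y)) e" and eu: "\<And>x. x \<in> carrier X \<Longrightarrow> e (u x) = w x"
      using approx[OF P_fg[OF \<Omega>Y] P_projective[OF \<Omega>Y] w] by blast
    \<comment> \<open>The factorization of \<open>h'\<close> after \<open>\<eta>\<close> over a
      projective has been extended from \<open>X\<close> to \<open>Q\<close>. On the image of
      \<open>u\<close>, \<open>v\<close> agrees with \<open>k\<close> after \<open>\<kappa>\<close>,
      so their difference descends to \<open>C\<close>.\<close>
    define v where "v = (\<lambda>y. i Y (q (FOb \<Omega> Y) (e y)))"
    have qe: "lin A Q (FOb \<Omega> Y) (\<lambda>y. q (FOb \<Omega> Y) (e y))"
      by (rule lin_compose[OF e q_lin[OF \<Omega>Y]])
    have v: "lin A Q (P Y) v"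
      unfolding v_def by (rule lin_compose[OF qe i_lin[OF Y]])
    have k\<kappa>: "lin A Q (P Y) (\<lambda>y. k (\<kappa> y))" by (rule lin_compose[OF \<kappa> k])
    have "k (\<kappa> (u x)) = v (u x)" if x: "x \<in> carrier X" for x
      using ih[OF linD(1)[OF \<eta> x]] i\<eta>[OF x] hw[OF x] eu[OF x] by (simp add: v_def)
    then have "k (\<kappa> y) \<ominus>\<^bsub>P Y\<^esub> v y = \<zero>\<^bsub>P Y\<^esub>" if y: "y \<in> carrier Q" "c y = \<zero>\<^bsub>C\<^esub>" for y
      using ker[OF y(1)] y(2) linD(1)[OF v y(1)] by (auto simp: PY.minus_eq_zero_iff)
    then obtain t where t: "lin A C (P Y) t" and tc: "\<And>y. y \<in> carrier Q \<Longrightarrow> t (c y) = k (\<kappa> y) \<ominus>\<^bsub>P Y\<^esub> v y"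
      using factor_through_surj[OF Q' right_module_fg[OF C] Y'(2) c lin_minus[OF Y'(2) k\<kappa> v]] by blast
    show "null C Y h"
    proof (rule nullI[OF t])
      fix z assume "z \<in> carrier C"
      then obtain y where y: "y \<in> carrier Q" and z: "z = c y" using c(2) by blast
      \<comment> \<open>\<open>v\<close> takes values in the image of \<open>i Y\<close>, which
        \<open>q Y\<close> kills; subtracting it leaves the map to \<open>Y\<close> unchanged, so
        \<open>t\<close> lifts \<open>h\<close>.\<close>
      have "q Y (t (c y)) = h (c y) \<ominus>\<^bsub>Y\<^esub> \<zero>\<^bsub>Y\<^esub>"
        unfolding tc[OF y] lin_minus_arg[OF Y'(2,1) q_lin[OF Y] linD(1)[OF k\<kappa> y] linD(1)[OF v y]]
          qk[OF linD(1)[OF \<kappa> y]] q\<kappa>[OF y]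
        using q_i[OF Y linD(1)[OF qe y]] by (simp add: v_def)
      then show "h z = q Y (t z)"
        using linD(1)[OF h linD(1)[OF c(1) y]] by (simp add: z Y.minus_zero_right)
    qed
  qed
qed

lemma has_left_adjoint_\<Omega>: "has_left_adjoint (stable_cat A) (stable_cat A) \<Omega>"
proof (rule left_adjoint_of_universal_arrows[OF is_functor_\<Omega>], unfold Ob_stable_cat)
  fix X :: "('a, 'u) module"
  assume X: "X \<in> fg_mods A"
  let ?S = "stable_cat A :: (('a, 'u) module, ('u \<Rightarrow> 'u) set) cat"
  obtain C \<eta> where C: "C \<in> fg_mods A" and \<eta>: "lin A X (FOb \<Omega> C) \<eta>"
    and ex: "\<And>Y g. Y \<in> fg_mods A \<Longrightarrow> lin A X (FOb \<Omega> Y) g \<Longrightarrow>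
      \<exists>h h' k. lift_of C Y h h' k \<and> null X (FOb \<Omega> Y) (\<lambda>x. h' (\<eta> x) \<ominus>\<^bsub>FOb \<Omega> Y\<^esub> g x)"
    and un: "\<And>Y h h' k. Y \<in> fg_mods A \<Longrightarrow> lift_of C Y h h' k \<Longrightarrow>
      null X (FOb \<Omega> Y) (\<lambda>x. h' (\<eta> x)) \<Longrightarrow> null C Y h"
    using universal_arrow[OF X] by blast
  have comp: "Comp ?S X (FOb \<Omega> C) (FOb \<Omega> Y) (FHom \<Omega> C Y (cls C Y h)) (cls X (FOb \<Omega> C) \<eta>) =
      cls X (FOb \<Omega> Y) (\<lambda>x. h' (\<eta> x))" if Y: "Y \<in> fg_mods A" and l: "lift_of C Y h h' k" for Y h h' k
    unfolding FHom_cls[OF C Y l]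
    using l by (intro Comp_cls[OF X \<Omega>_fg[OF C] \<Omega>_fg[OF Y] \<eta>]) (simp add: lift_of_def)
  have "\<exists>!f. f \<in> Hom ?S C Y \<and>
      Comp ?S X (FOb \<Omega> C) (FOb \<Omega> Y) (FHom \<Omega> C Y f) (cls X (FOb \<Omega> C) \<eta>) = g"
    if Y: "Y \<in> fg_mods A" and g: "g \<in> Hom ?S X (FOb \<Omega> Y)" for Y g
  proof -
    note \<Omega>Y = \<Omega>_fg[OF Y]
    obtain g' where g': "lin A X (FOb \<Omega> Y) g'" "g = cls X (FOb \<Omega> Y) g'"
      using g Hom_stable_cat_iff[OF X] by blast
    obtain h h' k where l: "lift_of C Y h h' k"
      and n: "null X (FOb \<Omega> Y) (\<lambda>x. h' (\<eta> x) \<ominus>\<^bsub>FOb \<Omega> Y\<^esub> g' x)"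
      using ex[OF Y g'(1)] by blast
    have h: "lin A C Y h" "lin A (FOb \<Omega> C) (FOb \<Omega> Y) h'" using l by (auto simp: lift_of_def)
    have gh: "g = cls X (FOb \<Omega> Y) (\<lambda>x. h' (\<eta> x))"
      using cls_eq_iff[OF X \<Omega>Y lin_compose[OF \<eta> h(2)] g'(1)] n g'(2) by simp
    show ?thesis
    proof (rule ex1I[of _ "cls C Y h"])
      show "cls C Y h \<in> Hom ?S C Y \<and>
          Comp ?S X (FOb \<Omega> C) (FOb \<Omega> Y) (FHom \<Omega> C Y (cls C Y h)) (cls X (FOb \<Omega> C) \<eta>) = g"
        using comp[OF Y l] gh cls_in_Hom[OF C h(1)] by simp
      fix f assume f: "f \<in> Hom ?S C Y \<and>
          Comp ?S X (FOb \<Omega> C) (FOb \<Omega> Y) (FHom \<Omega> C Y f) (cls X (FOb \<Omega> C) \<eta>) = g"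
      then obtain h2 where h2: "lin A C Y h2" "f = cls C Y h2" using Hom_stable_cat_iff[OF C] by blast
      obtain h2' k2 where l2: "lift_of C Y h2 h2' k2" using ex_lift_of[OF C Y h2(1)] by blast
      have h2': "lin A (FOb \<Omega> C) (FOb \<Omega> Y) h2'" using l2 by (simp add: lift_of_def)
      have "cls X (FOb \<Omega> Y) (\<lambda>x. h2' (\<eta> x)) = cls X (FOb \<Omega> Y) (\<lambda>x. h' (\<eta> x))"
        using f comp[OF Y l2] h2(2) gh by simp
      then have "null X (FOb \<Omega> Y) (\<lambda>x. h2' (\<eta> x) \<ominus>\<^bsub>FOb \<Omega> Y\<^esub> h' (\<eta> x))"
        using cls_eq_iff[OF X \<Omega>Y lin_compose[OF \<eta> h2'] lin_compose[OF \<eta> h(2)]] by simp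
      \<comment> \<open>The difference of the two lifts is a lift of \<open>h2\<close> minus
        \<open>h\<close>, and its transpose has just been seen to be null.\<close>
      then have "null C Y (\<lambda>z. h2 z \<ominus>\<^bsub>Y\<^esub> h z)"
        by (rule un[OF Y lift_of_minus[OF C Y l2 l]])
      then show "f = cls C Y h" using cls_eq_iff[OF C Y h2(1) h(1)] h2(2) by simp
    qed
  qed
  then show "\<exists>K\<in>fg_mods A. \<exists>\<eta>\<in>Hom ?S X (FOb \<Omega> K). \<forall>Y\<in>fg_mods A. \<forall>g\<in>Hom ?S X (FOb \<Omega> Y).
      \<exists>!h. h \<in> Hom ?S K Y \<and> Comp ?S X (FOb \<Omega> K) (FOb \<Omega> Y) (FHom \<Omega> K Y h) \<eta> = g"
    using C cls_in_Hom[OF X \<eta>] by blast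
qed

end

text \<open>Any finite ring is covered. The work lies in reading the extensional equations and the
  kernel in \<open>short_exact\<close> pointwise, as the locale expects them.\<close>

lemma heller_operator_has_left_adjoint:
  fixes A :: "('a, 'r) ring_scheme"
    and \<Omega> :: "(('a, 'u::infinite) module, ('u \<Rightarrow> 'u) set, ('a, 'u) module, ('u \<Rightarrow> 'u) set) functor_data"
  assumes A: "ring A" "finite (carrier A)" and \<Omega>: "heller_operator A \<Omega>"
  shows "has_left_adjoint (stable_cat A) (stable_cat A) \<Omega>"
proof -
  obtain P i q where ob: "\<forall>X\<in>fg_mods A. FOb \<Omega> X \<in> fg_mods A \<and> P X \<in> fg_mods A \<and> projective A (P X) \<and>
        short_exact A (FOb \<Omega> X) (i X) (P X) (q X) X"
    and mor: "\<forall>X\<in>fg_mods A. \<forall>Y\<in>fg_mods A. \<forall>h\<in>rhom A X Y.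
        \<exists>h'\<in>rhom A (FOb \<Omega> X) (FOb \<Omega> Y). \<exists>k\<in>rhom A (P X) (P Y).
          compose (carrier (P X)) (q Y) k = compose (carrier (P X)) h (q X) \<and>
          compose (carrier (FOb \<Omega> X)) (i Y) h' = compose (carrier (FOb \<Omega> X)) k (i X) \<and>
          FHom \<Omega> X Y (stable_class A X Y h) = stable_class A (FOb \<Omega> X) (FOb \<Omega> Y) h'"
    using \<Omega> unfolding heller_operator_def by blast
  interpret enough_projectives A P q
  proof (rule enough_projectives.intro[OF A])
    fix X :: "('a, 'u) module"
    assume X: "X \<in> fg_mods A"
    show "P X \<in> fg_mods A" "projective A (P X)" "lin A (P X) X (q X)" "q X ` carrier (P X) = carrier X"
      using bspec[OF ob X] by (simp_all add: short_exact_def rhom_iff)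
  qed
  interpret heller A P q \<Omega> i
  proof
    fix X :: "('a, 'u) module"
    assume X: "X \<in> fg_mods A"
    then show "FOb \<Omega> X \<in> fg_mods A" "lin A (FOb \<Omega> X) (P X) (i X)" "inj_on (i X) (carrier (FOb \<Omega> X))"
      "i X ` carrier (FOb \<Omega> X) = {y \<in> carrier (P X). q X y = \<zero>\<^bsub>X\<^esub>}"
      using ob by (auto simp: short_exact_def rhom_iff a_kernel_def')
  next
    fix X Y :: "('a, 'u) module" and h
    assume X: "X \<in> fg_mods A" and Y: "Y \<in> fg_mods A" and h: "lin A X Y h"
    obtain h' k where h': "h' \<in> rhom A (FOb \<Omega> X) (FOb \<Omega> Y)" and k: "k \<in> rhom A (P X) (P Y)"
      and qk: "compose (carrier (P X)) (q Y) k = compose (carrier (P X)) (restrict h (carrier X)) (q X)"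
      and ih: "compose (carrier (FOb \<Omega> X)) (i Y) h' = compose (carrier (FOb \<Omega> X)) k (i X)"
      and F: "FHom \<Omega> X Y (cls X Y h) = stable_class A (FOb \<Omega> X) (FOb \<Omega> Y) h'"
      using mor X Y rhom_restrict[OF right_module_fg[OF X] h] unfolding cls_def by blast
    have "q Y (k y) = h (q X y)" if "y \<in> carrier (P X)" for y
      using fun_cong[OF qk, of y] that linD(1)[OF q_lin[OF X] that] by (simp add: compose_def)
    moreover have "i Y (h' z) = k (i X z)" if "z \<in> carrier (FOb \<Omega> X)" for z
      using fun_cong[OF ih, of z] that by (simp add: compose_def)
    ultimately show "\<exists>h' k. lin A (FOb \<Omega> X) (FOb \<Omega> Y) h' \<and> lin A (P X) (P Y) k \<and>
        (\<forall>y\<in>carrier (P X). q Y (k y) = h (q X y)) \<and>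
        (\<forall>z\<in>carrier (FOb \<Omega> X). i Y (h' z) = k (i X z)) \<and>
        FHom \<Omega> X Y (cls X Y h) = cls (FOb \<Omega> X) (FOb \<Omega> Y) h'"
      using h' k F stable_class_eq_cls[OF h'] by (auto simp: rhom_iff)
  qed
  show ?thesis by (rule has_left_adjoint_\<Omega>)
qed

subsection \<open>The algebra is finite\<close>

text \<open>Division by the monic polynomial \<open>X^3\<close> leaves in every coset a remainder of
  degree below 3, given by three coefficients in the residue field.\<close>

lemma finite_R_mod_pi3:
  assumes "prime p"
  shows "finite (carrier (R_mod_pi3 p))"
proof -
  let ?F = "residue_ring (int p)"
  interpret F: residues_prime p ?F using assms by unfold_locales auto
  interpret U: UP_cring ?F "Fp_X p" by unfold_locales (simp add: Fp_X_def)
  let ?g = "monom (Fp_X p) \<one>\<^bsub>?F\<^esub> 3"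
  let ?I = "PIdl\<^bsub>Fp_X p\<^esub> ?g"
  have g: "pi_X p [^]\<^bsub>Fp_X p\<^esub> (3::nat) = ?g"
    unfolding pi_X_def by (simp add: U.monom_pow)
  have gc: "?g \<in> carrier (Fp_X p)" by simp
  have one: "\<one>\<^bsub>?F\<^esub> \<noteq> \<zero>\<^bsub>?F\<^esub>" by simp
  have g0: "?g \<noteq> \<zero>\<^bsub>Fp_X p\<^esub>" 
  proof
    assume "?g = \<zero>\<^bsub>Fp_X p\<^esub>"
    then have "coeff (Fp_X p) ?g 3 = \<zero>\<^bsub>?F\<^esub>" by simp
    then show False using one by simp
  qed
  interpret I: ideal ?I "Fp_X p" using gc by (rule U.P.cgenideal_ideal)
  \<comment> \<open>A polynomial is its coefficient function, so the remainders lie among the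
    functions supported on 0, 1 and 2.\<close>
  define S where "S = {r. \<forall>n. (n \<in> {..<3::nat} \<longrightarrow> r n \<in> carrier ?F) \<and> (n \<notin> {..<3} \<longrightarrow> r n = \<zero>\<^bsub>?F\<^esub>)}"
  have "finite S" unfolding S_def
    by (rule finite_set_of_finite_funs) auto
  moreover have "carrier (R_mod_pi3 p) \<subseteq> (\<lambda>r. ?I +>\<^bsub>Fp_X p\<^esub> r) ` S"
  proof
    fix c assume "c \<in> carrier (R_mod_pi3 p)"
    then obtain f where f: "f \<in> carrier (Fp_X p)" and c: "c = ?I +>\<^bsub>Fp_X p\<^esub> f"
      unfolding R_mod_pi3_def g FactRing_def A_RCOSETS_def' by auto
    have deg: "deg ?F ?g = 3" using one by simp
    \<comment> \<open>The division theorem multiplies \<open>f\<close> by a power of the leading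
      coefficient of the divisor; here this power is 1.\<close>
    have lc: "coeff (Fp_X p) ?g 3 [^]\<^bsub>?F\<^esub> k = \<one>\<^bsub>?F\<^esub>" for k :: nat
      by simp
    obtain q r k where q: "q \<in> carrier (Fp_X p)" and r: "r \<in> carrier (Fp_X p)"
      and "coeff (Fp_X p) ?g (deg ?F ?g) [^]\<^bsub>?F\<^esub> (k::nat) \<odot>\<^bsub>Fp_X p\<^esub> f
        = ?g \<otimes>\<^bsub>Fp_X p\<^esub> q \<oplus>\<^bsub>Fp_X p\<^esub> r"
      and "r = \<zero>\<^bsub>Fp_X p\<^esub> \<or> deg ?F r < deg ?F ?g"
      using U.long_div_theorem[OF gc f g0] by (elim exE conjE)
    then have e: "\<one>\<^bsub>?F\<^esub> \<odot>\<^bsub>Fp_X p\<^esub> f = ?g \<otimes>\<^bsub>Fp_X p\<^esub> q \<oplus>\<^bsub>Fp_X p\<^esub> r"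
      and d: "r = \<zero>\<^bsub>Fp_X p\<^esub> \<or> deg ?F r < 3"
      by (simp_all only: lc deg)
    have f_eq: "f = q \<otimes>\<^bsub>Fp_X p\<^esub> ?g \<oplus>\<^bsub>Fp_X p\<^esub> r"
      using e U.P.m_comm[OF gc q] U.smult_one[OF f] by (simp only:)
    have "q \<otimes>\<^bsub>Fp_X p\<^esub> ?g \<in> ?I"
      unfolding cgenideal_def using q by blast
    then have "f \<in> ?I +>\<^bsub>Fp_X p\<^esub> r"
      unfolding a_r_coset_def' using f_eq by blast
    then have "?I +>\<^bsub>Fp_X p\<^esub> r = c"
      unfolding c by (rule I.a_repr_independence'[OF _ r])
    moreover have "r \<in> S"
    proof -
      have co: "r n = coeff (Fp_X p) r n" for n using r by (simp add: Fp_X_def UP_def)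
      have "r n \<in> carrier ?F" for n by (subst co) (rule U.coeff_closed[OF r])
      moreover have "r n = \<zero>\<^bsub>?F\<^esub>" if "n \<ge> 3" for n
        by (subst co, rule disjE[OF d]) (use that U.deg_aboveD[OF _ r, of n] in auto)
      ultimately show ?thesis unfolding S_def by (simp add: not_less)
    qed
    ultimately show "c \<in> (\<lambda>r. ?I +>\<^bsub>Fp_X p\<^esub> r) ` S" by blast
  qed
  ultimately show ?thesis by (meson finite_surj)
qed

text \<open>The quiver has three paths, so an element of the algebra amounts to three elements of
  the finite coefficient ring.\<close>

lemma finite_alg_A:
  assumes "prime p"
  shows "finite (carrier (alg_A p))"
proof -
  let ?d = "{(V_e, []), (V_f, []), (V_e, [Arr_a])}"
  have "carrier (alg_A p) \<subseteq> {x. \<forall>r. (r \<in> ?d \<longrightarrow> x r \<in> carrier (R_mod_pi3 p)) \<and>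
      (r \<notin> ?d \<longrightarrow> x r = \<zero>\<^bsub>R_mod_pi3 p\<^esub>)}"
    unfolding alg_A_def path_algebra_ef_mem paths_quiver_ef
    using path_algebra_ef_mem paths_quiver_ef by (auto simp: path_algebra_ef_mem paths_quiver_ef)
  then show ?thesis
    by (rule finite_subset) (intro finite_set_of_finite_funs finite_R_mod_pi3 assms, simp)
qed

theorem proposition6:
  fixes p :: nat
    and \<Omega> :: "((vertex \<times> arrow list \<Rightarrow> (nat \<Rightarrow> int) set, 'u::infinite) module, ('u \<Rightarrow> 'u) set,
               (vertex \<times> arrow list \<Rightarrow> (nat \<Rightarrow> int) set, 'u) module, ('u \<Rightarrow> 'u) set) functor_data"
  assumes "prime p" and "p \<in> {2..997}"
    and "heller_operator (alg_A p) \<Omega>"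
  shows "has_left_adjoint (stable_cat (alg_A p)) (stable_cat (alg_A p)) \<Omega>"
  using assms by (intro heller_operator_has_left_adjoint ring_alg_A finite_alg_A)

end
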